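(* Assume that $(H_1)$, $(H_1^{\mathcal B})$ and $(H_2^{\mathcal B})$ (as stated in the context) hold, with activation functions $g_i$ of class $\mathcal B$. Then for each $\Sigma\in\{1,2\}^N$ there exists a unique almost periodic solution of (GNN) which is exponentially stable in $\mathcal K^\Sigma$.
   Context: **System.** Let $N,M\ge1$ be integers; indices satisfy $i,j\in\{1,\dots,N\}$, $l\in\{1,\dots,M\}$. The general neural network (GNN) is $$\frac{du^i(t)}{dt}=-c_i(t)u^i(t)+\sum_{l=1}^M\sum_{j=1}^N a_{ijl}(t)\,g_j\big(\sigma_j u^j(t-\kappa_{ijl}(t))\big)+J_i(t),\qquad i=1,\dots,N. \tag{GNN}$$ The delays satisfy $0<\kappa_{ijl}(t)\le\kappa_{ijl}$ with constants $\kappa_{ijl}$, and $\kappa:=\max_{i,j,l}\kappa_{ijl}$. For $\phi\in C([-\kappa,0],\mathbb R^N)$, $u(t;\phi)$ denotes the solution of (GNN) for $t\ge0$ with $u(s;\phi)=\phi(s)$ on $[-\kappa,0]$; for a function $u$ write $u_t(s)=u(t+s)$, $s\in[-\kappa,0]$. The norm is $\|\phi\|_\kappa=\max_i\sup_{s\in[-\kappa,0]}|\phi^i(s)|$. **Almost periodic** is in the sense of Bohr: a continuous $f:\mathbb R\to\mathbb R$ such that for each $\epsilon>0$ the set $\{T:|f(t+T)-f(t)|<\epsilon\ \forall t\in\mathbb R\}$ is relatively dense. A vector function is almost periodic if each component is. **$(H_1)$**: $c_i(t)>0$, $a_{ijl}(t)$, $\kappa_{ijl}(t)>0$, $J_i(t)$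 are almost periodic functions on $\mathbb R$; $\sigma_j>0$ are constants; $a_{iil}(t)>0$. **Class $\mathcal B$**: $g_j:\mathbb R\to\mathbb R$ is continuous with $g_j(x)=u_{j1}$ for $x<\ell_{j1}$, $g_j(x)=\tilde g_j(x)$ for $\ell_{j1}\le x\le\ell_{j2}$, $g_j(x)=u_{j2}$ for $x>\ell_{j2}$, where $\tilde g_j$ is a $C^1$ increasing function with $\tilde g_j(0)=0$, and $\ell_{j1}<0<\ell_{j2}$, $-\infty<u_{j1}<0<u_{j2}<+\infty$ are constants. Write $U_j:=\max\{|u_{j1}|,|u_{j2}|\}$. **Auxiliary functions**: $F_i(z)=-\big(\sup_{t}c_i(t)\big)z+\big(\inf_{t}\sum_{l=1}^M a_{iil}(t)\big)g_i(\sigma_i z)$. All $\sup$ and $\inf$ over $t$ are over $t\in\mathbb R$. **$(H_1^{\mathcal B})$**: for every $i$ and every $\zeta\in[\ell_{i1},\ell_{i2}]$, $\ \sup_tc_i(t)<\big(\inf_t\sum_{l=1}^Ma_{iil}(t)\big)\sigma_i\dot{\tilde g}_i(\zeta)$. **$(H_2^{\mathcal B})$**: for every $i$, $k=1,2$ and all $t\in\mathbb R$, $$(-1)^k\Big\{-\sup_tc_i(t)\frac{\ell_{ik}}{\sigma_i}+\Big(\inf_t\sum_{l=1}^Ma_{iil}(t)\Big)u_{ik}+J_i(t)\Big\}>\sum_{l=1}^M\sum_{j\ne i}\sup_t|a_{ijl}(t)|\,U_j .$$ **Basins**: $\beta_{i1}:=\hat\ell_{i1}$ is the point $\hat\ell_{i1}<\ell_{i1}/\sigma_i$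 with $F_i(\hat\ell_{i1})+\sum_l\sum_{j\ne i}\sup_t|a_{ijl}(t)|U_j+\sup_tJ_i(t)=0$; $\alpha_{i2}:=\tilde\ell_{i2}$ is the point $\tilde\ell_{i2}>\ell_{i2}/\sigma_i$ with $F_i(\tilde\ell_{i2})-\sum_l\sum_{j\ne i}\sup_t|a_{ijl}(t)|U_j+\inf_tJ_i(t)=0$. Set $$\mathcal K_{i1}=\{\psi\in C([-\kappa,0],\mathbb R):\psi(s)\le\beta_{i1}\ \forall s\},\qquad \mathcal K_{i2}=\{\psi\in C([-\kappa,0],\mathbb R):\psi(s)\ge\alpha_{i2}\ \forall s\},$$ and $\mathcal K^\Sigma=\mathcal K_{1\varsigma_1}\times\cdots\times\mathcal K_{N\varsigma_N}$ for $\Sigma=(\varsigma_1,\dots,\varsigma_N)\in\{1,2\}^N$. **Exponential stability**: an almost periodic solution $\hat u:\mathbb R\to\mathbb R^N$ of (GNN) is exponentially stable in $\mathcal K^\Sigma$ if $\hat u_t\in\mathcal K^\Sigma$ for all $t\in\mathbb R$ and there are constants $\rho\ge1$, $\mu>0$ such that $\max_i|\hat u^i(t)-u^i(t;\phi)|\le\rho e^{-\mu t}\|\hat u_0-\phi\|_\kappa$ for all $t\ge0$ and all $\phi\in\mathcal K^\Sigma$. *)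

theory Defs
  imports "HOL-Analysis.Analysis"
begin

definition relatively_dense :: "real set \<Rightarrow> bool" where
  "relatively_dense S \<longleftrightarrow> (\<exists>L>0. \<forall>x. S \<inter> {x..x + L} \<noteq> {})"

definition almost_periodic :: "(real \<Rightarrow> real) \<Rightarrow> bool" where
  "almost_periodic f \<longleftrightarrow> continuous_on UNIV f \<and>
     (\<forall>\<epsilon>>0. relatively_dense {T. \<forall>t. \<bar>f (t + T) - f t\<bar> < \<epsilon>})"

definition almost_periodic_vec :: "(real \<Rightarrow> real ^ 'n) \<Rightarrow> bool" where
  "almost_periodic_vec u \<longleftrightarrow> (\<forall>i. almost_periodic (\<lambda>t. u t $ i))"

text \<open>The neurons are indexed by the finite type \<open>'n\<close> (with \<open>N = CARD('n)\<close>) and the delayed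
  couplings by the finite type \<open>'m\<close> (with \<open>M = CARD('m)\<close>).  The fields stand for
  \<open>c\<^sub>i(t)\<close>, \<open>a\<^sub>i\<^sub>j\<^sub>l(t)\<close>, \<open>\<sigma>\<^sub>j\<close>, \<open>g\<^sub>j\<close>, \<open>\<kappa>\<^sub>i\<^sub>j\<^sub>l(t)\<close>, the constants \<open>\<kappa>\<^sub>i\<^sub>j\<^sub>l\<close>, and \<open>J\<^sub>i(t)\<close>.\<close>

record ('n, 'm) gnn =
  decay :: "'n \<Rightarrow> real \<Rightarrow> real"
  weight :: "'n \<Rightarrow> 'n \<Rightarrow> 'm \<Rightarrow> real \<Rightarrow> real"
  gain :: "'n \<Rightarrow> real"
  act :: "'n \<Rightarrow> real \<Rightarrow> real"
  delay :: "'n \<Rightarrow> 'n \<Rightarrow> 'm \<Rightarrow> real \<Rightarrow> real"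
  delay_bound :: "'n \<Rightarrow> 'n \<Rightarrow> 'm \<Rightarrow> real"
  ext_input :: "'n \<Rightarrow> real \<Rightarrow> real"

definition delays_bounded :: "('n::finite, 'm::finite) gnn \<Rightarrow> bool" where
  "delays_bounded G \<longleftrightarrow>
     (\<forall>i j l t. 0 < delay G i j l t \<and> delay G i j l t \<le> delay_bound G i j l)"

definition max_delay :: "('n::finite, 'm::finite) gnn \<Rightarrow> real" where
  "max_delay G = Max {delay_bound G i j l | i j l. True}"

definition gnn_rhs :: "('n::finite, 'm::finite) gnn \<Rightarrow> (real \<Rightarrow> real ^ 'n) \<Rightarrow> real \<Rightarrow> real ^ 'n" where
  "gnn_rhs G u t = (\<chi> i. - decay G i t * u t $ i
     + (\<Sum>l\<in>UNIV. \<Sum>j\<in>UNIV. weight G i j l t * act G j (gain G j * u (t - delay G i j l t) $ j))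
     + ext_input G i t)"

definition gnn_entire_solution :: "('n::finite, 'm::finite) gnn \<Rightarrow> (real \<Rightarrow> real ^ 'n) \<Rightarrow> bool" where
  "gnn_entire_solution G u \<longleftrightarrow> (\<forall>t. (u has_vector_derivative gnn_rhs G u t) (at t))"

text \<open>Only the restriction of a phase \<open>\<phi>\<close> to \<open>[-\<kappa>, 0]\<close> and of a solution \<open>u\<close> to \<open>[-\<kappa>, \<infinity>)\<close> is
  meaningful.  At \<open>t = 0\<close> the derivative is the right-hand one.\<close>

definition gnn_ivp_solution ::
  "('n::finite, 'm::finite) gnn \<Rightarrow> (real \<Rightarrow> real ^ 'n) \<Rightarrow> (real \<Rightarrow> real ^ 'n) \<Rightarrow> bool" where
  "gnn_ivp_solution G \<phi> u \<longleftrightarrow>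
     (\<forall>s\<in>{- max_delay G..0}. u s = \<phi> s) \<and>
     (\<forall>t\<ge>0. (u has_vector_derivative gnn_rhs G u t) (at t within {0..}))"

definition segment :: "(real \<Rightarrow> 'a) \<Rightarrow> real \<Rightarrow> real \<Rightarrow> 'a" where
  "segment u t = (\<lambda>s. u (t + s))"

definition phase_norm :: "('n::finite, 'm::finite) gnn \<Rightarrow> (real \<Rightarrow> real ^ 'n) \<Rightarrow> real" where
  "phase_norm G \<phi> = Max (range (\<lambda>i. SUP s\<in>{- max_delay G..0}. \<bar>\<phi> s $ i\<bar>))"

definition H1 :: "('n::finite, 'm::finite) gnn \<Rightarrow> bool" where
  "H1 G \<longleftrightarrow>
     (\<forall>i. almost_periodic (decay G i) \<and> (\<forall>t. decay G i t > 0)) \<and>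
     (\<forall>i j l. almost_periodic (weight G i j l)) \<and>
     (\<forall>i j l. almost_periodic (delay G i j l) \<and> (\<forall>t. delay G i j l t > 0)) \<and>
     (\<forall>i. almost_periodic (ext_input G i)) \<and>
     (\<forall>j. gain G j > 0) \<and>
     (\<forall>i l t. weight G i i l t > 0)"

text \<open>The breakpoints \<open>b k\<close> and saturation values \<open>v k\<close> are used for \<open>k \<in> {1, 2}\<close> only.
  The middle piece \<open>h\<close> is \<open>C\<^sup>1\<close> on the closed interval, with one-sided derivatives at its ends.\<close>

definition middle_deriv :: "(nat \<Rightarrow> real) \<Rightarrow> (real \<Rightarrow> real) \<Rightarrow> real \<Rightarrow> real" where
  "middle_deriv b h x = vector_derivative h (at x within {b 1..b 2})"

definition class_B :: "(nat \<Rightarrow> real) \<Rightarrow> (nat \<Rightarrow> real) \<Rightarrow> (real \<Rightarrow> real) \<Rightarrow> (real \<Rightarrow> real) \<Rightarrow> bool" where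
  "class_B b v h g \<longleftrightarrow>
     b 1 < 0 \<and> 0 < b 2 \<and> v 1 < 0 \<and> 0 < v 2 \<and>
     continuous_on UNIV g \<and>
     (\<forall>x. g x = (if x < b 1 then v 1 else if x \<le> b 2 then h x else v 2)) \<and>
     h differentiable_on {b 1..b 2} \<and> continuous_on {b 1..b 2} (middle_deriv b h) \<and>
     mono_on {b 1..b 2} h \<and> h 0 = 0"

definition sat_bound :: "('n \<Rightarrow> nat \<Rightarrow> real) \<Rightarrow> 'n \<Rightarrow> real" where
  "sat_bound v j = max \<bar>v j 1\<bar> \<bar>v j 2\<bar>"

definition sup_decay :: "('n::finite, 'm::finite) gnn \<Rightarrow> 'n \<Rightarrow> real" where
  "sup_decay G i = (SUP t. decay G i t)"

definition inf_self :: "('n::finite, 'm::finite) gnn \<Rightarrow> 'n \<Rightarrow> real" where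
  "inf_self G i = (INF t. \<Sum>l\<in>UNIV. weight G i i l t)"

definition cross_bound :: "('n::finite, 'm::finite) gnn \<Rightarrow> ('n \<Rightarrow> nat \<Rightarrow> real) \<Rightarrow> 'n \<Rightarrow> real" where
  "cross_bound G v i = (\<Sum>l\<in>UNIV. \<Sum>j\<in>UNIV - {i}. (SUP t. \<bar>weight G i j l t\<bar>) * sat_bound v j)"

definition F_aux :: "('n::finite, 'm::finite) gnn \<Rightarrow> 'n \<Rightarrow> real \<Rightarrow> real" where
  "F_aux G i z = - sup_decay G i * z + inf_self G i * act G i (gain G i * z)"

definition H1_B ::
  "('n::finite, 'm::finite) gnn \<Rightarrow> ('n \<Rightarrow> nat \<Rightarrow> real) \<Rightarrow> ('n \<Rightarrow> real \<Rightarrow> real) \<Rightarrow> bool" where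
  "H1_B G b h \<longleftrightarrow> (\<forall>i. \<forall>\<zeta>\<in>{b i 1..b i 2}.
     sup_decay G i < inf_self G i * gain G i * middle_deriv (b i) (h i) \<zeta>)"

definition H2_B ::
  "('n::finite, 'm::finite) gnn \<Rightarrow> ('n \<Rightarrow> nat \<Rightarrow> real) \<Rightarrow> ('n \<Rightarrow> nat \<Rightarrow> real) \<Rightarrow> bool" where
  "H2_B G b v \<longleftrightarrow> (\<forall>i. \<forall>k\<in>{1, 2}. \<forall>t.
     (-1) ^ k * (- sup_decay G i * (b i k / gain G i) + inf_self G i * v i k + ext_input G i t)
       > cross_bound G v i)"

text \<open>Since \<open>H2_B\<close> is strict only pointwise in \<open>t\<close>, the supremum of the input need not be
  attained and the root that defines the left edge may be \<open>b\<^sub>i\<^sub>1 / \<sigma>\<^sub>i\<close> itself; symmetrically on the right.  The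
  non-strict constraints below include this limit case, so that the edges always exist.  A root
  satisfying the strict constraint is always the one selected: see \<open>left_edge_eqI\<close> and
  \<open>right_edge_eqI\<close>.\<close>

definition left_edge ::
  "('n::finite, 'm::finite) gnn \<Rightarrow> ('n \<Rightarrow> nat \<Rightarrow> real) \<Rightarrow> ('n \<Rightarrow> nat \<Rightarrow> real) \<Rightarrow> 'n \<Rightarrow> real" where
  "left_edge G b v i = (THE z. z \<le> b i 1 / gain G i \<and>
     F_aux G i z + cross_bound G v i + (SUP t. ext_input G i t) = 0)"

definition right_edge ::
  "('n::finite, 'm::finite) gnn \<Rightarrow> ('n \<Rightarrow> nat \<Rightarrow> real) \<Rightarrow> ('n \<Rightarrow> nat \<Rightarrow> real) \<Rightarrow> 'n \<Rightarrow> real" where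
  "right_edge G b v i = (THE z. z \<ge> b i 2 / gain G i \<and>
     F_aux G i z - cross_bound G v i + (INF t. ext_input G i t) = 0)"

lemma class_B_left:
  assumes "class_B b v h g" "x \<le> b 1"
  shows "g x = v 1"
proof -
  have "closed {x. g x = v 1}"
    using assms(1) by (intro closed_Collect_eq) (auto simp: class_B_def)
  moreover have "{..<b 1} \<subseteq> {x. g x = v 1}"
    using assms(1) by (auto simp: class_B_def)
  ultimately have "closure {..<b 1} \<subseteq> {x. g x = v 1}"
    by (rule closure_minimal[rotated])
  with assms(2) show ?thesis by auto
qed

lemma class_B_right:
  assumes "class_B b v h g" "x \<ge> b 2"
  shows "g x = v 2"
proof -
  have "closed {x. g x = v 2}"
    using assms(1) by (intro closed_Collect_eq) (auto simp: class_B_def)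
  moreover have "{b 2<..} \<subseteq> {x. g x = v 2}"
    using assms(1) by (auto simp: class_B_def)
  ultimately have "closure {b 2<..} \<subseteq> {x. g x = v 2}"
    by (rule closure_minimal[rotated])
  with assms(2) show ?thesis by auto
qed

lemma left_edge_eqI:
  assumes "class_B (b i) (v i) (h i) (act G i)" "gain G i > 0" "sup_decay G i > 0"
    and "z < b i 1 / gain G i"
    and "F_aux G i z + cross_bound G v i + (SUP t. ext_input G i t) = 0"
  shows "left_edge G b v i = z"
  unfolding left_edge_def
proof (rule the_equality)
  have F: "F_aux G i y = - sup_decay G i * y + inf_self G i * v i 1" if "y \<le> b i 1 / gain G i" for y
    using class_B_left[OF assms(1), of "gain G i * y"] that assms(2)
    by (simp add: F_aux_def field_simps)
  fix y assume "y \<le> b i 1 / gain G i \<and> F_aux G i y + cross_bound G v i + (SUP t. ext_input G i t) = 0"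
  with assms(4,5) F[of y] F[of z] have "sup_decay G i * y = sup_decay G i * z" by linarith
  with assms(3) show "y = z" by simp
qed (use assms in auto)

lemma right_edge_eqI:
  assumes "class_B (b i) (v i) (h i) (act G i)" "gain G i > 0" "sup_decay G i > 0"
    and "z > b i 2 / gain G i"
    and "F_aux G i z - cross_bound G v i + (INF t. ext_input G i t) = 0"
  shows "right_edge G b v i = z"
  unfolding right_edge_def
proof (rule the_equality)
  have F: "F_aux G i y = - sup_decay G i * y + inf_self G i * v i 2" if "y \<ge> b i 2 / gain G i" for y
    using class_B_right[OF assms(1), of "gain G i * y"] that assms(2)
    by (simp add: F_aux_def field_simps)
  fix y assume "y \<ge> b i 2 / gain G i \<and> F_aux G i y - cross_bound G v i + (INF t. ext_input G i t) = 0"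
  with assms(4,5) F[of y] F[of z] have "sup_decay G i * y = sup_decay G i * z" by linarith
  with assms(3) show "y = z" by simp
qed (use assms in auto)

definition basin_comp ::
  "('n::finite, 'm::finite) gnn \<Rightarrow> ('n \<Rightarrow> nat \<Rightarrow> real) \<Rightarrow> ('n \<Rightarrow> nat \<Rightarrow> real) \<Rightarrow> 'n \<Rightarrow> nat
    \<Rightarrow> (real \<Rightarrow> real) set" where
  "basin_comp G b v i k = {\<psi>. continuous_on {- max_delay G..0} \<psi> \<and>
     (\<forall>s\<in>{- max_delay G..0}.
        if k = 1 then \<psi> s \<le> left_edge G b v i else \<psi> s \<ge> right_edge G b v i)}"

definition basin ::
  "('n::finite, 'm::finite) gnn \<Rightarrow> ('n \<Rightarrow> nat \<Rightarrow> real) \<Rightarrow> ('n \<Rightarrow> nat \<Rightarrow> real) \<Rightarrow> ('n \<Rightarrow> nat)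
    \<Rightarrow> (real \<Rightarrow> real ^ 'n) set" where
  "basin G b v \<Sigma> = {\<phi>. \<forall>i. (\<lambda>s. \<phi> s $ i) \<in> basin_comp G b v i (\<Sigma> i)}"

text \<open>That ``the'' solution \<open>u(t; \<phi>)\<close> obeys the estimate is rendered as: a solution with initial
  phase \<open>\<phi>\<close> exists, and all such solutions obey the estimate.\<close>

definition exp_stable_in ::
  "('n::finite, 'm::finite) gnn \<Rightarrow> (real \<Rightarrow> real ^ 'n) set \<Rightarrow> (real \<Rightarrow> real ^ 'n) \<Rightarrow> bool" where
  "exp_stable_in G K w \<longleftrightarrow>
     (\<forall>t. segment w t \<in> K) \<and>
     (\<exists>\<rho>\<ge>1. \<exists>\<mu>>0. \<forall>\<phi>\<in>K.
        (\<exists>u. gnn_ivp_solution G \<phi> u) \<and>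
        (\<forall>u. gnn_ivp_solution G \<phi> u \<longrightarrow>
           (\<forall>t\<ge>0. Max (range (\<lambda>i. \<bar>w t $ i - u t $ i\<bar>))
              \<le> \<rho> * exp (- \<mu> * t) * phase_norm G (\<lambda>s. segment w 0 s - \<phi> s))))"

end

theory Submission
  imports Defs
begin

text \<open>Inside a basin every activation is saturated, so a solution that stays there solves the
  decoupled scalar equations \<open>x' = - c\<^sub>i(t) x + A\<^sub>i(t)\<close> with almost periodic \<open>c\<^sub>i > 0\<close> and
  \<open>A\<^sub>i\<close>.  The choice of the edges makes the \<open>i\<close>-th edge \<open>e\<close> a super- or subsolution,
  \<open>A\<^sub>i(t) \<le> c\<^sub>i(t) e\<close> resp. \<open>A\<^sub>i(t) \<ge> c\<^sub>i(t) e\<close>, so each basin is positively invariant.  Since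
  \<open>c\<^sub>i\<close> has positive mean, differences of solutions decay exponentially and each scalar equation
  has exactly one bounded entire solution, which is almost periodic and lies in the basin.\<close>

section \<open>Almost periodic functions\<close>

text \<open>The functions \<open>decay\<close> and \<open>delay\<close> are positive only pointwise;
  an almost periodic function of this kind may have infimum 0, so neither a uniform decay rate nor a
  uniform step length is at hand. The first gap is filled by an antiderivative \<open>P\<close> of
  \<open>c\<close> with \<open>\<mu> * (t - s) - C \<le> P t - P s\<close>, where \<open>C\<close>
  pays for stretches of weak decay; the second by minima of the delays over compact intervals. The
  estimates on solutions are then comparisons for \<open>d * exp P\<close>: started at time 0 they
  give invariance and stability, started at \<open>- \<infinity>\<close> they give location, almost
  periodicity and uniqueness of bounded solutions. Since coefficient and forcing must be shifted
  together, almost periods common to finitely many functions are needed; they are drawn from total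
  boundedness of the set of translates.\<close>

lemma almost_periodicE:
  assumes "almost_periodic f" "\<epsilon> > 0"
  obtains L where "L > 0" "\<And>x. \<exists>T. x \<le> T \<and> T \<le> x + L \<and> (\<forall>t. \<bar>f (t + T) - f t\<bar> < \<epsilon>)"
proof -
  have "relatively_dense {T. \<forall>t. \<bar>f (t + T) - f t\<bar> < \<epsilon>}"
    using assms by (simp add: almost_periodic_def)
  then obtain L where L: "L > 0" "\<And>x. {T. \<forall>t. \<bar>f (t + T) - f t\<bar> < \<epsilon>} \<inter> {x..x + L} \<noteq> {}"
    unfolding relatively_dense_def by blast
  show thesis
  proof (rule that[OF L(1)])
    fix x
    show "\<exists>T. x \<le> T \<and> T \<le> x + L \<and> (\<forall>t. \<bar>f (t + T) - f t\<bar> < \<epsilon>)"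
      using L(2)[of x] by auto
  qed
qed

lemma almost_periodic_bounded:
  assumes "almost_periodic f"
  shows "\<exists>B. \<forall>t. \<bar>f t\<bar> \<le> B"
proof -
  obtain L where L: "L > 0" "\<And>x. \<exists>T. x \<le> T \<and> T \<le> x + L \<and> (\<forall>t. \<bar>f (t + T) - f t\<bar> < 1)"
    using almost_periodicE[OF assms, of 1] by auto
  have "bounded (f ` {0..L})"
    using assms
    by (intro compact_imp_bounded compact_continuous_image)
       (auto simp: almost_periodic_def intro: continuous_on_subset)
  then obtain B where B: "\<forall>x\<in>{0..L}. \<bar>f x\<bar> \<le> B"
    by (auto simp: bounded_iff)
  have "\<bar>f t\<bar> \<le> B + 1" for t
  proof -
    obtain T where "- t \<le> T" "T \<le> - t + L" "\<bar>f (t + T) - f t\<bar> < 1"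
      using L(2)[of "- t"] by blast
    with B show ?thesis by (smt (verit) atLeastAtMost_iff)
  qed
  then show ?thesis by blast
qed

lemma almost_periodic_bdd:
  assumes "almost_periodic f"
  shows "bdd_above (range f)" "bdd_below (range f)" "bdd_above (range (\<lambda>t. \<bar>f t\<bar>))"
proof -
  obtain B where "\<And>t. \<bar>f t\<bar> \<le> B"
    using almost_periodic_bounded[OF assms] by blast
  then have "f t \<le> B" "- B \<le> f t" "\<bar>f t\<bar> \<le> B" for t
    by (auto simp: abs_le_iff minus_le_iff)
  then show "bdd_above (range f)" "bdd_below (range f)" "bdd_above (range (\<lambda>t. \<bar>f t\<bar>))"
    by (auto intro!: bdd_aboveI[where M = B] bdd_belowI[where m = "- B"])
qed

lemma almost_periodic_uniformly_continuous:
  assumes "almost_periodic f"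
  shows "uniformly_continuous_on UNIV f"
  unfolding uniformly_continuous_on_def
proof (intro allI impI)
  fix e :: real assume "e > 0"
  obtain L where L: "L > 0" "\<And>x. \<exists>T. x \<le> T \<and> T \<le> x + L \<and> (\<forall>t. \<bar>f (t + T) - f t\<bar> < e / 3)"
    using almost_periodicE[OF assms, of "e / 3"] \<open>e > 0\<close> by auto
  \<comment> \<open>An almost period moves \<open>x\<close> into \<open>[0, L]\<close>; the margin 1
    on both sides leaves room for the neighbour \<open>y\<close>.\<close>
  have "uniformly_continuous_on {-1..L + 1} f"
    using assms
    by (intro compact_uniformly_continuous) (auto simp: almost_periodic_def intro: continuous_on_subset)
  then obtain d where d: "d > 0"
    "\<And>x y. x \<in> {-1..L + 1} \<Longrightarrow> y \<in> {-1..L + 1} \<Longrightarrow> \<bar>y - x\<bar> < d \<Longrightarrow> \<bar>f y - f x\<bar> < e / 3"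
    using uniformly_continuous_onE[of _ f "e / 3"] \<open>e > 0\<close> unfolding dist_real_def
    by (metis divide_pos_pos zero_less_numeral)
  have "\<bar>f y - f x\<bar> < e" if "\<bar>y - x\<bar> < min d 1" for x y
  proof -
    obtain T where T: "- x \<le> T" "T \<le> - x + L" "\<And>t. \<bar>f (t + T) - f t\<bar> < e / 3"
      using L(2)[of "- x"] by blast
    have "\<bar>f (y + T) - f (x + T)\<bar> < e / 3"
      using that T(1,2) by (intro d(2)) auto
    with T(3)[of x] T(3)[of y] show ?thesis by linarith
  qed
  then show "\<exists>d>0. \<forall>x\<in>UNIV. \<forall>x'\<in>UNIV. dist x' x < d \<longrightarrow> dist (f x') (f x) < e"
    using d(1) by (intro exI[of _ "min d 1"]) (auto simp: dist_real_def)
qed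

section \<open>Common almost periods and closure properties\<close>

text \<open>One half of Bochner's criterion. Up to an almost period every shift lies in
  \<open>[0, L]\<close>, and uniform continuity lets a finite net of that interval stand for all
  shifts.\<close>

lemma almost_periodic_translates_totally_bounded:
  assumes "almost_periodic f" "\<epsilon> > 0"
  shows "\<exists>H. finite H \<and> (\<forall>x. \<exists>k\<in>H. \<forall>t. \<bar>f (t + x) - f (t + k)\<bar> < \<epsilon>)"
proof -
  obtain L where L: "L > 0" "\<And>x. \<exists>T. x \<le> T \<and> T \<le> x + L \<and> (\<forall>t. \<bar>f (t + T) - f t\<bar> < \<epsilon> / 2)"
    using almost_periodicE[OF assms(1), of "\<epsilon> / 2"] assms(2) by auto
  obtain d where d: "d > 0" "\<And>x y. \<bar>y - x\<bar> < d \<Longrightarrow> \<bar>f y - f x\<bar> < \<epsilon> / 2"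
    using uniformly_continuous_onE[OF almost_periodic_uniformly_continuous[OF assms(1)], of "\<epsilon> / 2"] assms(2)
    unfolding dist_real_def by (metis UNIV_I half_gt_zero)
  obtain H where H: "finite H" "{0..L} \<subseteq> (\<Union>k\<in>H. ball k d)"
    using compact_Icc[of 0 L] d(1) unfolding compact_eq_totally_bounded by blast
  have "\<exists>k\<in>H. \<forall>t. \<bar>f (t + x) - f (t + k)\<bar> < \<epsilon>" for x
  proof -
    obtain T where T: "- x \<le> T" "T \<le> - x + L" "\<And>t. \<bar>f (t + T) - f t\<bar> < \<epsilon> / 2"
      using L(2)[of "- x"] by blast
    then have "x + T \<in> {0..L}" by auto
    then obtain k where k: "k \<in> H" "\<bar>k - (x + T)\<bar> < d"
      using H(2) by (auto simp: dist_real_def)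
    have "\<bar>f (t + x) - f (t + k)\<bar> < \<epsilon>" for t
    proof -
      have "\<bar>f (t + k) - f (t + (x + T))\<bar> < \<epsilon> / 2"
        using k(2) by (intro d(2)) simp
      moreover have "\<bar>f (t + (x + T)) - f (t + x)\<bar> < \<epsilon> / 2"
        using T(3)[of "t + x"] by (simp add: add.assoc)
      ultimately show ?thesis by linarith
    qed
    with k(1) show ?thesis by blast
  qed
  with H(1) show ?thesis by blast
qed

text \<open>Relatively dense sets may be disjoint, so the almost periods of the single functions
  cannot just be intersected. Instead a pigeonhole argument is used: if two shifts have the same net
  point for every function of \<open>S\<close>, their difference is an almost period of all of
  them.\<close>

lemma almost_periodic_common_periods:
  assumes "finite S" "\<And>f. f \<in> S \<Longrightarrow> almost_periodic f" "\<epsilon> > 0"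
  shows "relatively_dense {T. \<forall>f\<in>S. \<forall>t. \<bar>f (t + T) - f t\<bar> < \<epsilon>}"
proof -
  have "\<exists>H. finite H \<and> (\<forall>x. \<exists>k\<in>H. \<forall>t. \<bar>f (t + x) - f (t + k)\<bar> < \<epsilon> / 2)" if "f \<in> S" for f
    using almost_periodic_translates_totally_bounded[of f "\<epsilon> / 2"] assms(2,3) that by (metis half_gt_zero)
  then obtain H where H: "\<And>f. f \<in> S \<Longrightarrow> finite (H f)"
      "\<And>f x. f \<in> S \<Longrightarrow> \<exists>k\<in>H f. \<forall>t. \<bar>f (t + x) - f (t + k)\<bar> < \<epsilon> / 2"
    by metis
  then obtain k where k: "\<And>f x. f \<in> S \<Longrightarrow> k f x \<in> H f"
      "\<And>f x t. f \<in> S \<Longrightarrow> \<bar>f (t + x) - f (t + k f x)\<bar> < \<epsilon> / 2"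
    by metis
  \<comment> \<open>\<open>r x\<close> lists the net points of the shift \<open>x\<close>. It has
    finitely many values, so a finite set \<open>R\<close> of shifts attains them all; with
    \<open>R\<close> inside \<open>[-B, B]\<close>, subtracting a representative from
    \<open>x + B\<close> lands in \<open>[x, x + 2 * B]\<close>.\<close>
  define r where "r x = restrict (\<lambda>f. k f x) S" for x
  have "range r \<subseteq> PiE S H" using k(1) by (auto simp: r_def)
  then have fin: "finite (range r)"
    by (rule finite_subset) (intro finite_PiE assms(1) H(1))
  obtain R where R: "finite R" "range r = r ` R"
    using finite_subset_image[OF fin, of r UNIV] by blast
  obtain B where B: "B > 0" "\<forall>y\<in>R. \<bar>y\<bar> \<le> B"
    using finite_imp_bounded[OF R(1)] by (auto simp: bounded_pos)
  show ?thesis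
    unfolding relatively_dense_def
  proof (intro exI[of _ "2 * B"] conjI allI)
    fix x
    obtain y where y: "y \<in> R" "r (x + B) = r y"
      using R(2) by (metis UNIV_I image_iff)
    let ?T = "x + B - y"
    have "\<bar>f (t + ?T) - f t\<bar> < \<epsilon>" if f: "f \<in> S" for f t
    proof -
      have "k f (x + B) = k f y"
        using fun_cong[OF y(2), of f] f by (simp add: r_def)
      then have "\<bar>f (t + ?T) - f (t - y + k f y)\<bar> < \<epsilon> / 2"
        using k(2)[OF f, of "t - y" "x + B"] by (simp add: algebra_simps)
      moreover have "\<bar>f t - f (t - y + k f y)\<bar> < \<epsilon> / 2"
        using k(2)[OF f, of "t - y" y] by simp
      ultimately show ?thesis by linarith
    qed
    moreover have "?T \<in> {x..x + 2 * B}" using B(2) y(1) by (auto simp: abs_le_iff)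
    ultimately show "{T. \<forall>f\<in>S. \<forall>t. \<bar>f (t + T) - f t\<bar> < \<epsilon>} \<inter> {x..x + 2 * B} \<noteq> {}" by blast
  qed (use B(1) in simp)
qed

lemma relatively_dense_mono: "relatively_dense A \<Longrightarrow> A \<subseteq> B \<Longrightarrow> relatively_dense B"
  unfolding relatively_dense_def by (meson disjoint_iff subset_iff)

lemma almost_periodic_const: "almost_periodic (\<lambda>_. c)"
  by (auto simp: almost_periodic_def relatively_dense_def intro: exI[of _ 1])

lemma almost_periodic_add:
  assumes "almost_periodic f" "almost_periodic g"
  shows "almost_periodic (\<lambda>t. f t + g t)"
  unfolding almost_periodic_def
proof (intro conjI allI impI)
  show "continuous_on UNIV (\<lambda>t. f t + g t)"
    using assms by (auto simp: almost_periodic_def intro!: continuous_intros)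
  fix \<epsilon> :: real assume "\<epsilon> > 0"
  then have "relatively_dense {T. \<forall>k\<in>{f, g}. \<forall>t. \<bar>k (t + T) - k t\<bar> < \<epsilon> / 2}"
    using assms by (intro almost_periodic_common_periods) auto
  then show "relatively_dense {T. \<forall>t. \<bar>f (t + T) + g (t + T) - (f t + g t)\<bar> < \<epsilon>}"
  proof (rule relatively_dense_mono; safe)
    fix T t assume *: "\<forall>k\<in>{f, g}. \<forall>t. \<bar>k (t + T) - k t\<bar> < \<epsilon> / 2"
    then have "\<bar>f (t + T) - f t\<bar> < \<epsilon> / 2" "\<bar>g (t + T) - g t\<bar> < \<epsilon> / 2" by blast+
    then show "\<bar>f (t + T) + g (t + T) - (f t + g t)\<bar> < \<epsilon>" by linarith
  qed
qed

lemma almost_periodic_cmult: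
  assumes "almost_periodic f"
  shows "almost_periodic (\<lambda>t. f t * c)"
proof (cases "c = 0")
  case False
  show ?thesis
    unfolding almost_periodic_def
  proof (intro conjI allI impI)
    show "continuous_on UNIV (\<lambda>t. f t * c)"
      using assms by (auto simp: almost_periodic_def intro!: continuous_intros)
    fix \<epsilon> :: real assume "\<epsilon> > 0"
    then have "relatively_dense {T. \<forall>t. \<bar>f (t + T) - f t\<bar> < \<epsilon> / \<bar>c\<bar>}"
      using assms False by (simp add: almost_periodic_def)
    then show "relatively_dense {T. \<forall>t. \<bar>f (t + T) * c - f t * c\<bar> < \<epsilon>}"
      by (rule relatively_dense_mono)
         (use False in \<open>auto simp: pos_less_divide_eq abs_mult simp flip: left_diff_distrib\<close>)
  qed
qed (simp add: almost_periodic_const)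

lemma almost_periodic_sum:
  assumes "\<And>k. k \<in> A \<Longrightarrow> almost_periodic (f k)"
  shows "almost_periodic (\<lambda>t. \<Sum>k\<in>A. f k t)"
  using assms
  by (induction A rule: infinite_finite_induct) (auto intro: almost_periodic_const almost_periodic_add)

section \<open>Scalar linear equations\<close>

lemma antiderivative_exists:
  fixes f :: "real \<Rightarrow> real"
  assumes "continuous_on UNIV f"
  shows "\<exists>F. \<forall>t. (F has_real_derivative f t) (at t)"
proof -
  have "\<exists>F. \<forall>x. - \<infinity> < ereal x \<longrightarrow> ereal x < \<infinity> \<longrightarrow> (F has_vector_derivative f x) (at x)"
    using assms by (intro einterval_antiderivative) (auto simp: continuous_on_eq_continuous_at)
  then show ?thesis by (simp add: has_real_derivative_iff_has_vector_derivative)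
qed

text \<open>With the integrating factor, \<open>d * exp P\<close> has derivative
  \<open>(d' + c * d) * exp P \<le> 0\<close>. One-sided derivatives at the ends admit solutions
  that start at time 0.\<close>

lemma linear_comparison:
  fixes d P :: "real \<Rightarrow> real"
  assumes "a \<le> b"
    and P: "\<And>s. s \<in> {a..b} \<Longrightarrow> (P has_real_derivative c s) (at s within {a..b})"
    and d: "\<And>s. s \<in> {a..b} \<Longrightarrow> (d has_real_derivative d' s) (at s within {a..b})"
    and le: "\<And>s. s \<in> {a..b} \<Longrightarrow> d' s \<le> - c s * d s"
  shows "d b * exp (P b) \<le> d a * exp (P a)"
proof (rule DERIV_nonpos_imp_decreasing_open[OF \<open>a \<le> b\<close>, of "\<lambda>s. d s * exp (P s)"])
  have *: "((\<lambda>s. d s * exp (P s)) has_real_derivative (d' s + c s * d s) * exp (P s)) (at s within {a..b})"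
    if "s \<in> {a..b}" for s
    using P[OF that] d[OF that] by (auto intro!: derivative_eq_intros simp: algebra_simps)
  then show "continuous_on {a..b} (\<lambda>s. d s * exp (P s))"
    by (rule DERIV_continuous_on)
  fix s assume s: "a < s" "s < b"
  then have "((\<lambda>s. d s * exp (P s)) has_real_derivative (d' s + c s * d s) * exp (P s)) (at s)"
    using *[of s] by (simp add: at_within_Icc_at)
  moreover have "(d' s + c s * d s) * exp (P s) \<le> 0"
    using le[of s] s by (simp add: mult_le_0_iff)
  ultimately show "\<exists>y. ((\<lambda>s. d s * exp (P s)) has_real_derivative y) (at s) \<and> y \<le> 0" by blast
qed

lemma linear_solution_exists:
  assumes P: "\<And>t. (P has_real_derivative c t) (at t)" and "continuous_on UNIV A"
  shows "\<exists>y. y 0 = y0 \<and> (\<forall>t. (y has_real_derivative - c t * y t + A t) (at t))"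
proof -
  have "continuous_on UNIV P"
    by (intro continuous_at_imp_continuous_on ballI DERIV_isCont[OF P])
  then have "continuous_on UNIV (\<lambda>t. exp (P t) * A t)"
    using assms(2) by (intro continuous_intros)
  then obtain Q where Q: "\<And>t. (Q has_real_derivative exp (P t) * A t) (at t)"
    using antiderivative_exists by blast
  \<comment> \<open>Variation of constants, normalised at time 0.\<close>
  define y where "y t = (Q t - Q 0 + y0 * exp (P 0)) * exp (- P t)" for t
  have "(y has_real_derivative - c t * y t + A t) (at t)" for t
    unfolding y_def
    by (rule derivative_eq_intros P Q refl | simp)+
       (simp add: algebra_simps flip: exp_add)
  moreover have "y 0 = y0" by (simp add: y_def exp_minus)
  ultimately show ?thesis by blast
qed

text \<open>Although \<open>c\<close> need not be bounded away from zero, it exceeds half of \<open>c 0\<close> near each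
  almost period.\<close>

lemma almost_periodic_pos_growth:
  assumes ap: "almost_periodic c" and pos: "\<And>t. c t > 0"
    and P: "\<And>t. (P has_real_derivative c t) (at t)"
  shows "\<exists>\<mu>>0. \<exists>C. \<forall>s t. s \<le> t \<longrightarrow> \<mu> * (t - s) - C \<le> P t - P s"
proof -
  have mono: "P s \<le> P t" if "s \<le> t" for s t
    using that
  proof (rule DERIV_nonneg_imp_nondecreasing)
    show "\<exists>y. (P has_real_derivative y) (at x) \<and> 0 \<le> y" for x
      using P[of x] pos[of x] less_imp_le by blast
  qed
  \<comment> \<open>Two errors below \<open>m\<close>, from the almost period and from continuity at
    0, leave \<open>c s > c 0 - 2 * m = 2 * m\<close>; the growth estimate uses the lower bound
    \<open>m\<close>.\<close>
  define m where "m = c 0 / 4"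
  have m: "m > 0" using pos[of 0] by (simp add: m_def)
  obtain L where L: "L > 0" "\<And>x. \<exists>T. x \<le> T \<and> T \<le> x + L \<and> (\<forall>t. \<bar>c (t + T) - c t\<bar> < m)"
    using almost_periodicE[OF ap m] by auto
  have "isCont c 0" using ap by (auto simp: almost_periodic_def continuous_on_eq_continuous_at)
  then obtain d0 where d0: "d0 > 0" "\<And>x. \<bar>x\<bar> < d0 \<Longrightarrow> \<bar>c x - c 0\<bar> < m"
    using m unfolding continuous_at_eps_delta dist_real_def by auto
  define d where "d = d0 / 2"
  have d: "d > 0" "\<And>x. \<bar>x\<bar> \<le> d \<Longrightarrow> \<bar>c x - c 0\<bar> < m"
    using d0 by (auto simp: d_def)
  \<comment> \<open>Each window of length \<open>K\<close> contains \<open>[T, T + d]\<close> for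
    some almost period \<open>T\<close>, where \<open>P\<close> gains at least \<open>m * d\<close>;
    elsewhere \<open>P\<close> is merely nondecreasing.\<close>
  define K where "K = L + d"
  define \<eta> where "\<eta> = m * d"
  have K: "K > 0" and \<eta>: "\<eta> > 0" using L(1) d(1) m by (auto simp: K_def \<eta>_def)
  have step: "P (x + K) - P x \<ge> \<eta>" for x
  proof -
    obtain T where T: "x \<le> T" "T \<le> x + L" "\<And>t. \<bar>c (t + T) - c t\<bar> < m"
      using L(2) by blast
    have "P T - m * T \<le> P (T + d) - m * (T + d)"
    proof (rule DERIV_nonneg_imp_nondecreasing[of _ _ "\<lambda>s. P s - m * s"])
      fix s assume s: "T \<le> s" "s \<le> T + d"
      have "\<bar>c s - c (s - T)\<bar> < m" using T(3)[of "s - T"] by simp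
      moreover have "\<bar>c (s - T) - c 0\<bar> < m" using s by (intro d(2)) auto
      ultimately have "c s - m \<ge> 0" using m unfolding m_def by linarith
      then show "\<exists>y. ((\<lambda>s. P s - m * s) has_real_derivative y) (at s) \<and> 0 \<le> y"
        by (intro exI[of _ "c s - m"]) (auto intro!: derivative_eq_intros P)
    qed (use d in auto)
    then have "P (T + d) - P T \<ge> \<eta>" by (simp add: \<eta>_def algebra_simps)
    moreover have "P x \<le> P T" "P (T + d) \<le> P (x + K)"
      using T by (auto intro!: mono simp: K_def)
    ultimately show ?thesis by linarith
  qed
  have steps: "P (x + real n * K) - P x \<ge> real n * \<eta>" for n x
  proof (induction n)
    case (Suc n)
    then show ?case using step[of "x + real n * K"] by (simp add: algebra_simps)
  qed simp
  \<comment> \<open>Only complete windows are counted; the subtracted \<open>\<eta>\<close> covers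
    the incomplete last one.\<close>
  have "\<eta> / K * (t - s) - \<eta> \<le> P t - P s" if "s \<le> t" for s t
  proof -
    define n where "n = nat \<lfloor>(t - s) / K\<rfloor>"
    have n: "real n \<le> (t - s) / K" "(t - s) / K \<le> real n + 1"
      using that K unfolding n_def by (auto simp: of_nat_nat)
    have "s + real n * K \<le> t" using n(1) K by (simp add: field_simps)
    then have "P t - P s \<ge> real n * \<eta>" using steps[of n s] mono by fastforce
    moreover have "(t - s) / K * \<eta> \<le> (real n + 1) * \<eta>" using n(2) \<eta> by (intro mult_right_mono) auto
    ultimately show ?thesis by (simp add: algebra_simps)
  qed
  moreover have "\<eta> / K > 0" using K \<eta> by simp
  ultimately show ?thesis by blast
qed

section \<open>Bounded entire solutions under decay in the mean\<close>

locale stable_decay =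
  fixes c P :: "real \<Rightarrow> real" and \<mu> C :: real
  assumes antideriv: "\<And>t. (P has_real_derivative c t) (at t)"
    and rate_pos: "\<mu> > 0"
    and growth: "\<And>s t. s \<le> t \<Longrightarrow> \<mu> * (t - s) - C \<le> P t - P s"
begin

lemma exp_vanishes: "(\<lambda>n. exp (P (t - real n))) \<longlonglongrightarrow> 0"
proof (rule tendsto_sandwich[of "\<lambda>_. 0" _ _ "\<lambda>n. exp (P t + C) * exp (- \<mu>) ^ n"])
  have "exp (P (t - real n)) \<le> exp (P t + C) * exp (- \<mu>) ^ n" for n
    using growth[of "t - real n" t]
    by (simp add: algebra_simps flip: exp_add exp_of_nat_mult)
  then show "\<forall>\<^sub>F n in sequentially. exp (P (t - real n)) \<le> exp (P t + C) * exp (- \<mu>) ^ n" by simp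
  have "(\<lambda>n. exp (P t + C) * exp (- \<mu>) ^ n) \<longlonglongrightarrow> exp (P t + C) * 0"
    using rate_pos by (intro tendsto_intros LIMSEQ_realpow_zero) auto
  then show "(\<lambda>n. exp (P t + C) * exp (- \<mu>) ^ n) \<longlonglongrightarrow> 0" by simp
qed auto

text \<open>Comparison on \<open>[t - n, t]\<close> damps the starting value, at most
  \<open>B\<close>, by a factor that vanishes as \<open>n\<close> grows. An upper bound on the whole
  line thus takes the place of an initial condition.\<close>

lemma bounded_subsolution_nonpos:
  assumes d: "\<And>t. (d has_real_derivative d' t) (at t)"
    and le: "\<And>t. d' t \<le> - c t * d t"
    and bd: "\<And>t. d t \<le> B"
  shows "d t \<le> 0"
proof -
  have "d t * exp (P t) \<le> B * exp (P (t - real n))" for n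
  proof -
    have "d t * exp (P t) \<le> d (t - real n) * exp (P (t - real n))"
      using le by (intro linear_comparison[where c = c and d' = d'])
        (auto intro: has_field_derivative_at_within antideriv d)
    also have "\<dots> \<le> B * exp (P (t - real n))" using bd by (intro mult_right_mono) auto
    finally show ?thesis .
  qed
  moreover have "(\<lambda>n. B * exp (P (t - real n))) \<longlonglongrightarrow> B * 0"
    by (intro tendsto_intros exp_vanishes)
  ultimately have "d t * exp (P t) \<le> 0"
    by (intro LIMSEQ_le_const[of "\<lambda>n. B * exp (P (t - real n))"]) auto
  then show ?thesis by (simp add: mult_le_0_iff)
qed

text \<open>The solution is the integral of \<open>exp (P s - P t) * A s\<close> over
  \<open>s \<le> t\<close>. It is obtained without improper integrals: if \<open>q\<close> is the
  limit of an antiderivative \<open>Q\<close> of \<open>exp P * A\<close> at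
  \<open>- \<infinity>\<close>, then \<open>Q t - q\<close> is the integral up to
  \<open>t\<close>.\<close>

lemma bounded_solution_exists:
  assumes "continuous_on UNIV A" and M: "\<And>t. \<bar>A t\<bar> \<le> M"
  shows "\<exists>w B. \<forall>t. (w has_real_derivative - c t * w t + A t) (at t) \<and> \<bar>w t\<bar> \<le> B"
proof -
  have contP: "continuous_on UNIV P"
    by (intro continuous_at_imp_continuous_on ballI DERIV_isCont[OF antideriv])
  have "continuous_on UNIV (\<lambda>t. exp (P t) * A t)"
    using assms(1) contP by (intro continuous_intros)
  then obtain Q where Q: "\<And>t. (Q has_real_derivative exp (P t) * A t) (at t)"
    using antiderivative_exists by blast
  have M0: "M \<ge> 0" using M[of 0] by linarith
  \<comment> \<open>By the growth bound, \<open>R t\<close> is an antiderivative of a majorant of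
    \<open>\<bar>exp (P s) * A s\<bar>\<close> on \<open>s \<le> t\<close>. Monotonicity of
    \<open>R t - Q\<close> and \<open>R t + Q\<close> then replaces the estimate of the
    integral.\<close>
  define R where "R t s = M / \<mu> * exp (P t + C + \<mu> * (s - t))" for t s
  have R0: "R t s \<ge> 0" for t s using M0 rate_pos by (simp add: R_def)
  have Rder: "(R t has_real_derivative M * exp (P t + C + \<mu> * (s - t))) (at s)" for t s
    unfolding R_def using rate_pos by (auto intro!: derivative_eq_intros)
  have QR: "\<bar>Q t - Q s\<bar> \<le> R t t" if "s \<le> t" for s t
  proof -
    have bnd: "\<bar>exp (P x) * A x\<bar> \<le> M * exp (P t + C + \<mu> * (x - t))" if "x \<le> t" for x
    proof -
      have "exp (P x) \<le> exp (P t + C + \<mu> * (x - t))"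
        using growth[OF that] by (simp add: algebra_simps)
      then have "exp (P x) * \<bar>A x\<bar> \<le> exp (P t + C + \<mu> * (x - t)) * M"
        using M[of x] by (intro mult_mono) auto
      then show ?thesis by (simp add: abs_mult mult.commute)
    qed
    have "R t s - Q s \<le> R t t - Q t"
    proof (rule DERIV_nonneg_imp_nondecreasing[OF that, of "\<lambda>x. R t x - Q x"])
      fix x assume "x \<le> t"
      from bnd[OF this] show "\<exists>y. ((\<lambda>x. R t x - Q x) has_real_derivative y) (at x) \<and> 0 \<le> y"
        by (intro exI[of _ "M * exp (P t + C + \<mu> * (x - t)) - exp (P x) * A x"] conjI
            DERIV_diff Rder Q) auto
    qed
    moreover have "R t s + Q s \<le> R t t + Q t"
    proof (rule DERIV_nonneg_imp_nondecreasing[OF that, of "\<lambda>x. R t x + Q x"])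
      fix x assume "x \<le> t"
      from bnd[OF this] show "\<exists>y. ((\<lambda>x. R t x + Q x) has_real_derivative y) (at x) \<and> 0 \<le> y"
        by (intro exI[of _ "M * exp (P t + C + \<mu> * (x - t)) + exp (P x) * A x"] conjI
            DERIV_add Rder Q) auto
    qed
    ultimately show ?thesis using R0[of t s] by (auto simp: abs_le_iff)
  qed
  have Rtt: "R t t = M / \<mu> * exp C * exp (P t)" for t by (simp add: R_def exp_add)
  have Rlim: "(\<lambda>n. R (- real n) (- real n)) \<longlonglongrightarrow> 0"
    unfolding Rtt using tendsto_mult_right_zero[OF exp_vanishes[of 0], of "M / \<mu> * exp C"] by simp
  have "Cauchy (\<lambda>n. Q (- real n))"
  proof (rule metric_CauchyI)
    fix e :: real assume "e > 0"
    then have "\<forall>\<^sub>F n in sequentially. R (- real n) (- real n) < e / 2"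
      using order_tendstoD(2)[OF Rlim, of "e / 2"] by simp
    then obtain N where N: "R (- real N) (- real N) < e / 2"
      by (auto simp: eventually_sequentially)
    have "dist (Q (- real m)) (Q (- real n)) < e" if "m \<ge> N" "n \<ge> N" for m n
      using QR[of "- real m" "- real N"] QR[of "- real n" "- real N"] that N
      by (simp add: dist_real_def)
    then show "\<exists>N. \<forall>m\<ge>N. \<forall>n\<ge>N. dist (Q (- real m)) (Q (- real n)) < e" by blast
  qed
  then obtain q where q: "(\<lambda>n. Q (- real n)) \<longlonglongrightarrow> q"
    using Cauchy_convergent convergent_def by metis
  have Qq: "\<bar>Q t - q\<bar> \<le> R t t" for t
  proof (rule LIMSEQ_le_const2)
    show "(\<lambda>n. \<bar>Q t - Q (- real n)\<bar>) \<longlonglongrightarrow> \<bar>Q t - q\<bar>"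
      by (intro tendsto_intros q)
    obtain N where "real N \<ge> - t" using real_arch_simple by blast
    then show "\<exists>N. \<forall>n\<ge>N. \<bar>Q t - Q (- real n)\<bar> \<le> R t t"
      by (intro exI[of _ N] allI impI QR) linarith
  qed
  \<comment> \<open>The bound \<open>R t t\<close> on \<open>\<bar>Q t - q\<bar>\<close> is a
    constant multiple of \<open>exp (P t)\<close>, which the factor \<open>exp (- P t)\<close>
    cancels.\<close>
  define w where "w t = exp (- P t) * (Q t - q)" for t
  have "(w has_real_derivative - c t * w t + A t) (at t)" for t
    unfolding w_def
    by (rule derivative_eq_intros antideriv Q refl)+
       (simp add: algebra_simps flip: exp_add)
  moreover have "\<bar>w t\<bar> \<le> M / \<mu> * exp C" for t
  proof -
    have "\<bar>w t\<bar> \<le> exp (- P t) * R t t" using Qq[of t] by (simp add: w_def abs_mult)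
    also have "\<dots> = M / \<mu> * exp C" by (simp add: Rtt exp_minus)
    finally show ?thesis .
  qed
  ultimately show ?thesis by blast
qed

text \<open>The difference of \<open>w\<close> and its translate is dominated by a small multiple of the bounded
  solution \<open>z\<close> of \<open>z' = - c z + 1\<close>.\<close>

lemma bounded_solution_almost_periodic:
  assumes c: "almost_periodic c" and A: "almost_periodic A"
    and w: "\<And>t. (w has_real_derivative - c t * w t + A t) (at t)"
    and B: "\<And>t. \<bar>w t\<bar> \<le> B"
  shows "almost_periodic w"
  unfolding almost_periodic_def
proof (intro conjI allI impI)
  show "continuous_on UNIV w"
    by (intro continuous_at_imp_continuous_on ballI DERIV_isCont[OF w])
  fix \<epsilon> :: real assume \<epsilon>: "\<epsilon> > 0"
  obtain z Z where z: "\<And>t. (z has_real_derivative - c t * z t + 1) (at t)" and Z: "\<And>t. \<bar>z t\<bar> \<le> Z"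
    using bounded_solution_exists[of "\<lambda>_. 1" 1] by auto
  have B0: "B \<ge> 0" and Z0: "Z \<ge> 0" using B[of 0] Z[of 0] by linarith+
  \<comment> \<open>Shifts of \<open>A\<close> and \<open>c\<close> by a common
    \<open>\<delta>\<close>-period change the equation by at most
    \<open>\<delta> + \<delta> * B = e\<close>. The choice gives
    \<open>e * (2 * (1 + Z)) = \<epsilon>\<close>, hence \<open>e * Z < \<epsilon>\<close>.\<close>
  define \<delta> where "\<delta> = \<epsilon> / (2 * (1 + B) * (1 + Z))"
  have \<delta>: "\<delta> > 0" using \<epsilon> B0 Z0 by (simp add: \<delta>_def)
  define e where "e = \<delta> * (1 + B)"
  have e: "e > 0" using \<delta> B0 by (simp add: e_def)
  have "e * Z < e * (2 * (1 + Z))" using e Z0 by simp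
  also have "\<dots> = \<epsilon>" using B0 Z0 by (simp add: e_def \<delta>_def divide_simps) (simp add: algebra_simps)
  finally have eZ: "e * Z < \<epsilon>" .
  have "relatively_dense {T. \<forall>f\<in>{c, A}. \<forall>t. \<bar>f (t + T) - f t\<bar> < \<delta>}"
    using c A \<delta> by (intro almost_periodic_common_periods) auto
  then show "relatively_dense {T. \<forall>t. \<bar>w (t + T) - w t\<bar> < \<epsilon>}"
  proof (rule relatively_dense_mono; safe)
    fix T t assume *: "\<forall>f\<in>{c, A}. \<forall>t. \<bar>f (t + T) - f t\<bar> < \<delta>"
    \<comment> \<open>This is the residual: \<open>D s = w (s + T) - w s\<close> solves
      \<open>D' = - c D + r\<close> with the unshifted \<open>c\<close>.\<close>
    define r where "r s = A (s + T) - A s - (c (s + T) - c s) * w (s + T)" for s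
    have r: "\<bar>r s\<bar> \<le> e" for s
    proof -
      have "\<bar>A (s + T) - A s\<bar> \<le> \<delta>" "\<bar>c (s + T) - c s\<bar> \<le> \<delta>"
        using * by (auto intro: less_imp_le)
      moreover from this(2) have "\<bar>(c (s + T) - c s) * w (s + T)\<bar> \<le> \<delta> * B"
        unfolding abs_mult using B \<delta> by (intro mult_mono) auto
      ultimately show ?thesis unfolding r_def e_def by (simp add: algebra_simps)
    qed
    have wT: "((\<lambda>s. w (s + T)) has_real_derivative - c (s + T) * w (s + T) + A (s + T)) (at s)" for s
      using w[of "s + T"] by (simp add: DERIV_shift)
    have zb: "\<bar>e * z s\<bar> \<le> e * Z" for s using Z[of s] e by (simp add: abs_mult)
    \<comment> \<open>\<open>e * z\<close> solves the same equation with
      \<open>e \<ge> \<bar>r\<bar>\<close> in place of \<open>r\<close>, so the difference is a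
      bounded subsolution.\<close>
    have "w (t + T) - w t - e * z t \<le> 0"
    proof (rule bounded_subsolution_nonpos[where d = "\<lambda>s. w (s + T) - w s - e * z s" and B = "2 * B + e * Z"])
      fix s
      show "((\<lambda>s. w (s + T) - w s - e * z s) has_real_derivative
          - c s * (w (s + T) - w s - e * z s) + r s - e) (at s)"
        by (rule derivative_eq_intros wT w z refl | simp)+ (simp add: r_def algebra_simps)
      show "- c s * (w (s + T) - w s - e * z s) + r s - e \<le> - c s * (w (s + T) - w s - e * z s)"
        using r[of s] by linarith
      show "w (s + T) - w s - e * z s \<le> 2 * B + e * Z"
        using B[of s] B[of "s + T"] zb[of s] by linarith
    qed
    moreover have "w t - w (t + T) - e * z t \<le> 0"
    proof (rule bounded_subsolution_nonpos[where d = "\<lambda>s. w s - w (s + T) - e * z s" and B = "2 * B + e * Z"])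
      fix s
      show "((\<lambda>s. w s - w (s + T) - e * z s) has_real_derivative
          - c s * (w s - w (s + T) - e * z s) - r s - e) (at s)"
        by (rule derivative_eq_intros wT w z refl | simp)+ (simp add: r_def algebra_simps)
      show "- c s * (w s - w (s + T) - e * z s) - r s - e \<le> - c s * (w s - w (s + T) - e * z s)"
        using r[of s] by linarith
      show "w s - w (s + T) - e * z s \<le> 2 * B + e * Z"
        using B[of s] B[of "s + T"] zb[of s] by linarith
    qed
    ultimately show "\<bar>w (t + T) - w t\<bar> < \<epsilon>" using zb[of t] eZ by linarith
  qed
qed

end

section \<open>The network inside a basin\<close>

lemma has_vector_derivative_vec_iff:
  fixes f :: "real \<Rightarrow> real ^ 'n::finite"
  shows "(f has_vector_derivative f') (at t within S) \<longleftrightarrow>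
    (\<forall>i. ((\<lambda>x. f x $ i) has_real_derivative f' $ i) (at t within S))"
  unfolding has_real_derivative_iff_has_vector_derivative has_vector_derivative_def
  by (subst has_derivative_componentwise_within) (auto simp: Basis_vec_def inner_axis)

locale saturating_gnn =
  fixes G :: "('n::finite, 'm::finite) gnn"
    and b v :: "'n \<Rightarrow> nat \<Rightarrow> real"
    and h :: "'n \<Rightarrow> real \<Rightarrow> real"
    and \<Sigma> :: "'n \<Rightarrow> nat"
  assumes delays: "delays_bounded G"
    and act: "\<And>j. class_B (b j) (v j) (h j) (act G j)"
    and H1: "H1 G" and H2_B: "H2_B G b v"
    and \<Sigma>: "\<And>i. \<Sigma> i \<in> {1, 2}"
begin

lemma
  shows decay_ap: "almost_periodic (decay G i)" and decay_pos: "decay G i t > 0"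
    and weight_ap: "almost_periodic (weight G i j l)"
    and delay_ap: "almost_periodic (delay G i j l)" and delay_pos: "delay G i j l t > 0"
    and input_ap: "almost_periodic (ext_input G i)"
    and gain_pos: "gain G i > 0"
  using H1 by (auto simp: H1_def)

lemma delay_le: "delay G i j l t \<le> max_delay G"
proof -
  have "finite ((\<lambda>(i, j, l). delay_bound G i j l) ` UNIV)" by simp
  also have "(\<lambda>(i, j, l). delay_bound G i j l) ` UNIV = {delay_bound G i j l | i j l. True}"
    by (auto simp: image_iff) blast
  finally have "delay_bound G i j l \<le> max_delay G"
    unfolding max_delay_def by (intro Max_ge) blast+
  with delays show ?thesis unfolding delays_bounded_def by (meson order_trans)
qed

lemma max_delay_pos: "max_delay G > 0"
  using delay_pos delay_le less_le_trans by blast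

text \<open>Compactness of \<open>[0, T]\<close> and finiteness of the index types yield the step
  length; it depends on \<open>T\<close>.\<close>

lemma min_delay: "\<exists>\<delta>>0. \<forall>i j l. \<forall>t\<in>{0..T}. \<delta> \<le> delay G i j l t"
proof (cases "T \<ge> 0")
  case True
  have "\<exists>\<delta>>0. \<forall>t\<in>{0..T}. \<delta> \<le> delay G i j l t" for i j l
  proof -
    have "continuous_on {0..T} (delay G i j l)"
      using delay_ap by (auto simp: almost_periodic_def intro: continuous_on_subset)
    then obtain s where "\<forall>t\<in>{0..T}. delay G i j l s \<le> delay G i j l t"
      using continuous_attains_inf[of "{0..T}" "delay G i j l"] True by auto
    then show ?thesis using delay_pos by blast
  qed
  then obtain d where d: "\<And>i j l. d i j l > 0" "\<And>i j l t. t \<in> {0..T} \<Longrightarrow> d i j l \<le> delay G i j l t"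
    by metis
  define D where "D = (\<lambda>(i, j, l). d i j l) ` UNIV"
  have D: "finite D" "D \<noteq> {}" "\<And>x. x \<in> D \<Longrightarrow> x > 0" "\<And>i j l. d i j l \<in> D"
    using d(1) by (auto simp: D_def image_iff)
  then have "Min D > 0" "\<And>i j l. Min D \<le> d i j l" by auto
  with d(2) show ?thesis by (meson order_trans)
qed (auto intro: exI[of _ 1])

lemma decay_le: "decay G i t \<le> sup_decay G i"
  unfolding sup_decay_def using almost_periodic_bdd(1)[OF decay_ap] by (intro cSUP_upper) auto

lemma sup_decay_pos: "sup_decay G i > 0"
  using decay_pos[of i 0] decay_le[of i 0] by linarith

lemma F_aux_left: "z \<le> b i 1 / gain G i \<Longrightarrow> F_aux G i z = - sup_decay G i * z + inf_self G i * v i 1"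
  using class_B_left[OF act, of "gain G i * z" i] gain_pos[of i] by (simp add: F_aux_def field_simps)

lemma F_aux_right: "z \<ge> b i 2 / gain G i \<Longrightarrow> F_aux G i z = - sup_decay G i * z + inf_self G i * v i 2"
  using class_B_right[OF act, of i "gain G i * z"] gain_pos[of i] by (simp add: F_aux_def field_simps)

section \<open>The edges of the basins\<close>

text \<open>Up to the breakpoint \<open>F_aux\<close> is affine with slope
  \<open>- sup_decay G i\<close>, so the root is an explicit quotient. \<open>H2_B\<close> at each
  \<open>t\<close> passes to the supremum of the input as a non-strict inequality and places that
  root.\<close>

lemma left_edge:
  shows "left_edge G b v i \<le> b i 1 / gain G i"
    and "sup_decay G i * left_edge G b v i =
      inf_self G i * v i 1 + cross_bound G v i + (SUP t. ext_input G i t)"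
proof -
  let ?S = "inf_self G i * v i 1 + cross_bound G v i + (SUP t. ext_input G i t)"
  have "ext_input G i t \<le> sup_decay G i * (b i 1 / gain G i) - inf_self G i * v i 1 - cross_bound G v i" for t
    using H2_B unfolding H2_B_def by (auto simp: algebra_simps dest!: spec[of _ i] spec[of _ t])
  then have "(SUP t. ext_input G i t) \<le>
      sup_decay G i * (b i 1 / gain G i) - inf_self G i * v i 1 - cross_bound G v i"
    by (intro cSUP_least) auto
  then have z: "?S / sup_decay G i \<le> b i 1 / gain G i"
    using sup_decay_pos[of i] by (subst pos_divide_le_eq) (auto simp: mult.commute)
  have "left_edge G b v i = ?S / sup_decay G i"
    unfolding left_edge_def
  proof (rule the_equality)
    show "?S / sup_decay G i \<le> b i 1 / gain G i \<and>
        F_aux G i (?S / sup_decay G i) + cross_bound G v i + (SUP t. ext_input G i t) = 0"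
      using z sup_decay_pos[of i] by (auto simp: F_aux_left)
    show "y = ?S / sup_decay G i"
      if "y \<le> b i 1 / gain G i \<and> F_aux G i y + cross_bound G v i + (SUP t. ext_input G i t) = 0" for y
      using that sup_decay_pos[of i] by (auto simp: F_aux_left field_simps)
  qed
  then show "left_edge G b v i \<le> b i 1 / gain G i" "sup_decay G i * left_edge G b v i = ?S"
    using z sup_decay_pos[of i] by auto
qed

lemma right_edge:
  shows "right_edge G b v i \<ge> b i 2 / gain G i"
    and "sup_decay G i * right_edge G b v i =
      inf_self G i * v i 2 - cross_bound G v i + (INF t. ext_input G i t)"
proof -
  let ?S = "inf_self G i * v i 2 - cross_bound G v i + (INF t. ext_input G i t)"
  have "ext_input G i t \<ge> sup_decay G i * (b i 2 / gain G i) - inf_self G i * v i 2 + cross_bound G v i" for t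
    using H2_B unfolding H2_B_def by (auto simp: algebra_simps dest!: spec[of _ i] spec[of _ t])
  then have "(INF t. ext_input G i t) \<ge>
      sup_decay G i * (b i 2 / gain G i) - inf_self G i * v i 2 + cross_bound G v i"
    by (intro cINF_greatest) auto
  then have z: "?S / sup_decay G i \<ge> b i 2 / gain G i"
    using sup_decay_pos[of i] by (subst pos_le_divide_eq) (auto simp: mult.commute)
  have "right_edge G b v i = ?S / sup_decay G i"
    unfolding right_edge_def
  proof (rule the_equality)
    show "?S / sup_decay G i \<ge> b i 2 / gain G i \<and>
        F_aux G i (?S / sup_decay G i) - cross_bound G v i + (INF t. ext_input G i t) = 0"
      using z sup_decay_pos[of i] by (auto simp: F_aux_right)
    show "y = ?S / sup_decay G i"
      if "y \<ge> b i 2 / gain G i \<and> F_aux G i y - cross_bound G v i + (INF t. ext_input G i t) = 0" for y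
      using that sup_decay_pos[of i] by (auto simp: F_aux_right field_simps)
  qed
  then show "right_edge G b v i \<ge> b i 2 / gain G i" "sup_decay G i * right_edge G b v i = ?S"
    using z sup_decay_pos[of i] by auto
qed

text \<open>The signs of the edges allow \<open>sup_decay\<close> to be traded for
  \<open>decay\<close> at time \<open>t\<close> in the right direction.\<close>

lemma left_edge_neg: "left_edge G b v i < 0"
proof -
  have "b i 1 / gain G i < 0"
    using act[of i] gain_pos[of i] by (simp add: class_B_def divide_neg_pos)
  with left_edge(1)[of i] show ?thesis by linarith
qed

lemma right_edge_pos: "right_edge G b v i > 0"
proof -
  have "b i 2 / gain G i > 0"
    using act[of i] gain_pos[of i] by (simp add: class_B_def)
  with right_edge(1)[of i] show ?thesis by linarith
qed

section \<open>Saturation and invariance\<close>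

text \<open>The condition that a basin puts on single values. Separated from continuity of the
  phase, it can be propagated in time.\<close>

definition well :: "'n \<Rightarrow> real \<Rightarrow> bool" where
  "well i x \<longleftrightarrow> (if \<Sigma> i = 1 then x \<le> left_edge G b v i else x \<ge> right_edge G b v i)"

definition forcing :: "'n \<Rightarrow> real \<Rightarrow> real" where
  "forcing i t = (\<Sum>l\<in>UNIV. \<Sum>j\<in>UNIV. weight G i j l t * v j (\<Sigma> j)) + ext_input G i t"

lemma act_saturated:
  assumes "well j x"
  shows "act G j (gain G j * x) = v j (\<Sigma> j)"
proof (cases "\<Sigma> j = 1")
  case True
  then have "x \<le> b j 1 / gain G j" using assms left_edge(1)[of j] by (simp add: well_def)
  then have "gain G j * x \<le> b j 1" using gain_pos[of j] by (simp add: field_simps)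
  with True show ?thesis using class_B_left[OF act] by simp
next
  case False
  then have "x \<ge> b j 2 / gain G j" using assms right_edge(1)[of j] by (simp add: well_def)
  then have "gain G j * x \<ge> b j 2" using gain_pos[of j] by (simp add: field_simps)
  with False show ?thesis using class_B_right[OF act] \<Sigma>[of j] by auto
qed

lemma rhs_saturated:
  assumes "\<And>j s. t - max_delay G \<le> s \<Longrightarrow> s < t \<Longrightarrow> well j (u s $ j)"
  shows "gnn_rhs G u t $ i = - decay G i t * u t $ i + forcing i t"
proof -
  have "act G j (gain G j * u (t - delay G i j l t) $ j) = v j (\<Sigma> j)" for j l
    using delay_le[of i j l t] delay_pos[of i j l t] by (intro act_saturated assms) auto
  then show ?thesis by (simp add: gnn_rhs_def forcing_def)
qed

lemma cross_bound: "\<bar>\<Sum>l\<in>UNIV. \<Sum>j\<in>UNIV - {i}. weight G i j l t * v j (\<Sigma> j)\<bar> \<le> cross_bound G v i"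
  unfolding cross_bound_def
proof (rule order_trans[OF sum_abs sum_mono], rule order_trans[OF sum_abs sum_mono])
  fix l j
  have "\<bar>weight G i j l t\<bar> \<le> (SUP t. \<bar>weight G i j l t\<bar>)"
    using almost_periodic_bdd(3)[OF weight_ap] by (intro cSUP_upper) auto
  moreover have "\<bar>v j (\<Sigma> j)\<bar> \<le> sat_bound v j"
    using \<Sigma>[of j] by (auto simp: sat_bound_def)
  ultimately show "\<bar>weight G i j l t * v j (\<Sigma> j)\<bar> \<le> (SUP t. \<bar>weight G i j l t\<bar>) * sat_bound v j"
    unfolding abs_mult by (intro mult_mono) auto
qed

lemma inf_self_le: "inf_self G i \<le> (\<Sum>l\<in>UNIV. weight G i i l t)"
  unfolding inf_self_def
  using almost_periodic_bdd(2)[OF almost_periodic_sum[OF weight_ap]] by (intro cINF_lower) auto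

text \<open>The self-coupling is set apart because the sign of \<open>v i (\<Sigma> i)\<close>
  decides which extreme of its weight is the worst case; the cross terms are bounded only in
  absolute value.\<close>

lemma forcing_split:
  "forcing i t = (\<Sum>l\<in>UNIV. weight G i i l t) * v i (\<Sigma> i)
    + (\<Sum>l\<in>UNIV. \<Sum>j\<in>UNIV - {i}. weight G i j l t * v j (\<Sigma> j)) + ext_input G i t"
  unfolding forcing_def
  by (subst sum.remove[of UNIV i]) (simp_all add: sum.distrib sum_distrib_right)

text \<open>Each part of the forcing is dominated by its counterpart in the equation of the edge. As
  \<open>v i 1 < 0\<close>, the largest self-coupling term belongs to the infimum of the
  weights.\<close>

lemma forcing_left:
  assumes "\<Sigma> i = 1"
  shows "forcing i t \<le> decay G i t * left_edge G b v i"
proof -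
  have "(\<Sum>l\<in>UNIV. weight G i i l t) * v i 1 \<le> inf_self G i * v i 1"
    using inf_self_le[of i t] act[of i] by (intro mult_right_mono_neg) (auto simp: class_B_def)
  moreover have "ext_input G i t \<le> (SUP t. ext_input G i t)"
    using almost_periodic_bdd(1)[OF input_ap] by (intro cSUP_upper) auto
  ultimately have "forcing i t \<le> sup_decay G i * left_edge G b v i"
    unfolding forcing_split left_edge(2) using cross_bound[of i t] assms by (simp add: abs_le_iff)
  also have "\<dots> \<le> decay G i t * left_edge G b v i"
    using decay_le[of i t] left_edge_neg[of i] by (intro mult_right_mono_neg) auto
  finally show ?thesis .
qed

lemma forcing_right:
  assumes "\<Sigma> i \<noteq> 1"
  shows "forcing i t \<ge> decay G i t * right_edge G b v i"
proof -
  have [simp]: "\<Sigma> i = 2" using \<Sigma>[of i] assms by auto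
  have "inf_self G i * v i 2 \<le> (\<Sum>l\<in>UNIV. weight G i i l t) * v i 2"
    using inf_self_le[of i t] act[of i] by (intro mult_right_mono) (auto simp: class_B_def)
  moreover have "(INF t. ext_input G i t) \<le> ext_input G i t"
    using almost_periodic_bdd(2)[OF input_ap] by (intro cINF_lower) auto
  ultimately have "sup_decay G i * right_edge G b v i \<le> forcing i t"
    unfolding forcing_split right_edge(2) using cross_bound[of i t] by (simp add: abs_le_iff)
  moreover have "decay G i t * right_edge G b v i \<le> sup_decay G i * right_edge G b v i"
    using decay_le[of i t] right_edge_pos[of i] by (intro mult_right_mono) auto
  ultimately show ?thesis by linarith
qed

lemma forcing_ap: "almost_periodic (forcing i)"
  unfolding forcing_def
  by (intro almost_periodic_add almost_periodic_sum almost_periodic_cmult weight_ap input_ap)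

lemma well_preserved:
  assumes "a \<le> t" "well i (y a)"
    and P: "\<And>s. (P has_real_derivative decay G i s) (at s)"
    and y: "\<And>s. s \<in> {a..t} \<Longrightarrow> (y has_real_derivative - decay G i s * y s + forcing i s) (at s within {a..t})"
  shows "well i (y t)"
proof (cases "\<Sigma> i = 1")
  case True
  let ?e = "left_edge G b v i"
  have "(y t - ?e) * exp (P t) \<le> (y a - ?e) * exp (P a)"
  proof (rule linear_comparison[OF \<open>a \<le> t\<close>, where c = "decay G i" and d = "\<lambda>s. y s - ?e"])
    fix s assume s: "s \<in> {a..t}"
    show "(P has_real_derivative decay G i s) (at s within {a..t})"
      by (rule has_field_derivative_at_within[OF P])
    show "((\<lambda>s. y s - ?e) has_real_derivative - decay G i s * y s + forcing i s) (at s within {a..t})"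
      using y[OF s] by (auto intro!: derivative_eq_intros)
    show "- decay G i s * y s + forcing i s \<le> - decay G i s * (y s - ?e)"
      using forcing_left[OF True, of s] by (simp add: algebra_simps)
  qed
  also have "\<dots> \<le> 0" using assms(2) True by (simp add: well_def mult_le_0_iff)
  finally show ?thesis using True by (simp add: well_def mult_le_0_iff)
next
  case False
  let ?e = "right_edge G b v i"
  have "(?e - y t) * exp (P t) \<le> (?e - y a) * exp (P a)"
  proof (rule linear_comparison[OF \<open>a \<le> t\<close>, where c = "decay G i" and d = "\<lambda>s. ?e - y s"])
    fix s assume s: "s \<in> {a..t}"
    show "(P has_real_derivative decay G i s) (at s within {a..t})"
      by (rule has_field_derivative_at_within[OF P])
    show "((\<lambda>s. ?e - y s) has_real_derivative - (- decay G i s * y s + forcing i s)) (at s within {a..t})"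
      using y[OF s] by (auto intro!: derivative_eq_intros)
    show "- (- decay G i s * y s + forcing i s) \<le> - decay G i s * (?e - y s)"
      using forcing_right[OF False, of s] by (simp add: algebra_simps)
  qed
  also have "\<dots> \<le> 0" using assms(2) False by (simp add: well_def mult_le_0_iff)
  finally show ?thesis using False by (simp add: well_def mult_le_0_iff)
qed

text \<open>The comparison of \<open>well_preserved\<close> started at \<open>- \<infinity>\<close>:
  boundedness replaces a starting value in the well.\<close>

lemma bounded_solution_well:
  assumes "stable_decay (decay G i) P \<mu> C"
    and y: "\<And>s. (y has_real_derivative - decay G i s * y s + forcing i s) (at s)"
    and B: "\<And>s. \<bar>y s\<bar> \<le> B"
  shows "well i (y t)"
proof (cases "\<Sigma> i = 1")
  case True
  let ?e = "left_edge G b v i"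
  have "y t - ?e \<le> 0"
  proof (rule stable_decay.bounded_subsolution_nonpos[OF assms(1), where d = "\<lambda>s. y s - ?e"])
    fix s
    show "((\<lambda>s. y s - ?e) has_real_derivative - decay G i s * y s + forcing i s) (at s)"
      using y[of s] by (auto intro!: derivative_eq_intros)
    show "- decay G i s * y s + forcing i s \<le> - decay G i s * (y s - ?e)"
      using forcing_left[OF True, of s] by (simp add: algebra_simps)
    show "y s - ?e \<le> B - ?e" using B[of s] by (simp add: abs_le_iff)
  qed
  then show ?thesis using True by (simp add: well_def)
next
  case False
  let ?e = "right_edge G b v i"
  have "?e - y t \<le> 0"
  proof (rule stable_decay.bounded_subsolution_nonpos[OF assms(1), where d = "\<lambda>s. ?e - y s"])
    fix s
    show "((\<lambda>s. ?e - y s) has_real_derivative - (- decay G i s * y s + forcing i s)) (at s)"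
      using y[of s] by (auto intro!: derivative_eq_intros)
    show "- (- decay G i s * y s + forcing i s) \<le> - decay G i s * (?e - y s)"
      using forcing_right[OF False, of s] by (simp add: algebra_simps)
    show "?e - y s \<le> ?e + B" using B[of s] by (simp add: abs_le_iff)
  qed
  then show ?thesis using False by (simp add: well_def)
qed

text \<open>The growth bound survives a smaller \<open>\<mu>\<close> and a larger \<open>C\<close>,
  so minimum and maximum over the finitely many neurons serve all of them.\<close>

lemma stable_decay_exists: "\<exists>P \<mu> C. \<forall>i. stable_decay (decay G i) (P i) \<mu> C"
proof -
  have "\<exists>P. \<forall>t. (P has_real_derivative decay G i t) (at t)" for i
    using decay_ap[of i] by (intro antiderivative_exists) (simp add: almost_periodic_def)
  then obtain P where P: "\<And>i t. (P i has_real_derivative decay G i t) (at t)" by metis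
  have "\<exists>\<mu>>0. \<exists>C. \<forall>s t. s \<le> t \<longrightarrow> \<mu> * (t - s) - C \<le> P i t - P i s" for i
    by (rule almost_periodic_pos_growth[OF decay_ap decay_pos P])
  then obtain \<mu> C where \<mu>: "\<And>i. \<mu> i > 0"
    and C: "\<And>i s t. s \<le> t \<Longrightarrow> \<mu> i * (t - s) - C i \<le> P i t - P i s" by metis
  have "stable_decay (decay G i) (P i) (Min (range \<mu>)) (Max (range C))" for i
  proof
    show "Min (range \<mu>) > 0" using \<mu> by (subst Min_gr_iff) auto
    fix s t :: real assume "s \<le> t"
    then have "Min (range \<mu>) * (t - s) \<le> \<mu> i * (t - s)" by (intro mult_right_mono) auto
    moreover have "C i \<le> Max (range C)" by simp
    ultimately show "Min (range \<mu>) * (t - s) - Max (range C) \<le> P i t - P i s"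
      using C[OF \<open>s \<le> t\<close>, of i] by linarith
  qed (rule P)
  then show ?thesis by blast
qed

section \<open>Initial value problems with phase in the basin\<close>

lemma basin_iff:
  "\<phi> \<in> basin G b v \<Sigma> \<longleftrightarrow>
    (\<forall>i. continuous_on {- max_delay G..0} (\<lambda>s. \<phi> s $ i)) \<and>
    (\<forall>i. \<forall>s\<in>{- max_delay G..0}. well i (\<phi> s $ i))"
  by (auto simp: basin_def basin_comp_def well_def)

text \<open>The decoupled equations remember only the value at time 0. Continuity on the compact
  interval keeps the supremum in \<open>phase_norm\<close> meaningful.\<close>

lemma phase_norm_ge:
  assumes "\<And>i. continuous_on {- max_delay G..0} (\<lambda>s. \<phi> s $ i)"
  shows "\<bar>\<phi> 0 $ i\<bar> \<le> phase_norm G \<phi>"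
proof -
  let ?I = "{- max_delay G..0}"
  have "bounded ((\<lambda>s. \<phi> s $ i) ` ?I)"
    by (intro compact_imp_bounded compact_continuous_image assms) auto
  then obtain B where B: "\<forall>s\<in>?I. \<bar>\<phi> s $ i\<bar> \<le> B" by (auto simp: bounded_iff)
  then have "bdd_above ((\<lambda>s. \<bar>\<phi> s $ i\<bar>) ` ?I)" by (intro bdd_aboveI[where M = B]) auto
  then have "\<bar>\<phi> 0 $ i\<bar> \<le> (SUP s\<in>?I. \<bar>\<phi> s $ i\<bar>)"
    using max_delay_pos by (intro cSUP_upper) auto
  also have "\<dots> \<le> phase_norm G \<phi>" unfolding phase_norm_def by (intro Max_ge) auto
  finally show ?thesis .
qed

text \<open>Method of steps: on a bounded time interval the delays are bounded below, so each step sees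
  only saturated activations.\<close>

lemma ivp_solution_well:
  assumes u: "gnn_ivp_solution G \<phi> u" and \<phi>: "\<phi> \<in> basin G b v \<Sigma>"
    and "t \<ge> - max_delay G"
  shows "well i (u t $ i)"
proof -
  obtain P \<mu> C where P: "\<And>i. stable_decay (decay G i) (P i) \<mu> C"
    using stable_decay_exists by blast
  define T where "T = max t 0"
  obtain \<delta> where \<delta>: "\<delta> > 0" "\<And>i j l t. t \<in> {0..T} \<Longrightarrow> \<delta> \<le> delay G i j l t"
    using min_delay[of T] by blast
  have init: "well i (u s $ i)" if "- max_delay G \<le> s" "s \<le> 0" for i s
    using u \<phi> that by (auto simp: gnn_ivp_solution_def basin_iff)
  have der: "((\<lambda>s. u s $ i) has_real_derivative gnn_rhs G u s $ i) (at s within {0..})" if "s \<ge> 0" for i s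
    using u that by (auto simp: gnn_ivp_solution_def has_vector_derivative_vec_iff)
  \<comment> \<open>For \<open>r \<le> (n + 1) * \<delta>\<close> in \<open>[0, T]\<close> all
    delayed times are at most \<open>n * \<delta>\<close>, so the hypothesis for \<open>n\<close>
    linearises the equation on the whole of \<open>[0, s]\<close> and each comparison can restart at
    0.\<close>
  have "\<forall>i s. - max_delay G \<le> s \<longrightarrow> s \<le> T \<longrightarrow> s \<le> real n * \<delta> \<longrightarrow> well i (u s $ i)" for n
  proof (induction n)
    case 0
    then show ?case using init by simp
  next
    case (Suc n)
    show ?case
    proof (intro allI impI)
      fix i s assume s: "- max_delay G \<le> s" "s \<le> T" "s \<le> real (Suc n) * \<delta>"
      show "well i (u s $ i)"
      proof (cases "s \<le> 0")
        case False
        show ?thesis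
        proof (rule well_preserved[where a = 0 and y = "\<lambda>s. u s $ i" and P = "P i"])
          show "0 \<le> s" using False by simp
          show "well i (u 0 $ i)" using init max_delay_pos by simp
          show "(P i has_real_derivative decay G i r) (at r)" for r
            by (rule stable_decay.antideriv[OF P])
          fix r assume r: "r \<in> {0..s}"
          have "act G j (gain G j * u (r - delay G i j l r) $ j) = v j (\<Sigma> j)" for j l
          proof -
            have "\<delta> \<le> delay G i j l r" using r s by (intro \<delta>(2)) auto
            then have "r - delay G i j l r \<le> real n * \<delta>" "r - delay G i j l r \<le> T"
              using r s \<delta>(1) by (auto simp: algebra_simps)
            moreover have "- max_delay G \<le> r - delay G i j l r"
              using delay_le[of i j l r] r by auto
            ultimately show ?thesis using Suc.IH by (intro act_saturated) blast
          qed
          then have "gnn_rhs G u r $ i = - decay G i r * u r $ i + forcing i r"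
            by (simp add: gnn_rhs_def forcing_def)
          with der[of r i] r
          show "((\<lambda>s. u s $ i) has_real_derivative - decay G i r * u r $ i + forcing i r) (at r within {0..s})"
            by (auto intro: has_field_derivative_subset)
        qed
      qed (use init s in auto)
    qed
  qed
  moreover obtain n where "T \<le> real n * \<delta>"
    using reals_Archimedean3[OF \<delta>(1)] less_imp_le by meson
  ultimately show ?thesis using assms(3) by (auto simp: T_def)
qed

lemma ivp_solution_linear:
  assumes u: "gnn_ivp_solution G \<phi> u" and \<phi>: "\<phi> \<in> basin G b v \<Sigma>" and "t \<ge> 0"
  shows "((\<lambda>s. u s $ i) has_real_derivative - decay G i t * u t $ i + forcing i t) (at t within {0..})"
proof -
  have "gnn_rhs G u t $ i = - decay G i t * u t $ i + forcing i t"
    using \<open>t \<ge> 0\<close> by (intro rhs_saturated ivp_solution_well[OF u \<phi>]) auto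
  moreover have "((\<lambda>s. u s $ i) has_real_derivative gnn_rhs G u t $ i) (at t within {0..})"
    using u \<open>t \<ge> 0\<close> by (auto simp: gnn_ivp_solution_def has_vector_derivative_vec_iff)
  ultimately show ?thesis by simp
qed

text \<open>The order is reversed to avoid a fixed point argument: the decoupled linear equations
  are solved first, and invariance of the wells then shows that the result solves the
  network.\<close>

lemma ivp_solution_exists:
  assumes \<phi>: "\<phi> \<in> basin G b v \<Sigma>"
  shows "\<exists>u. gnn_ivp_solution G \<phi> u"
proof -
  obtain P \<mu> C where P: "\<And>i. stable_decay (decay G i) (P i) \<mu> C"
    using stable_decay_exists by blast
  have "\<exists>y. y 0 = \<phi> 0 $ i \<and> (\<forall>t. (y has_real_derivative - decay G i t * y t + forcing i t) (at t))" for i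
    using forcing_ap[of i]
    by (intro linear_solution_exists[OF stable_decay.antideriv[OF P]]) (simp add: almost_periodic_def)
  then obtain y where y0: "\<And>i. y i 0 = \<phi> 0 $ i"
    and y: "\<And>i t. (y i has_real_derivative - decay G i t * y i t + forcing i t) (at t)" by metis
  define u where "u t = (if t \<le> 0 then \<phi> t else (\<chi> i. y i t))" for t
  have u: "u t $ i = y i t" if "t \<ge> 0" for t i
    using that y0 by (cases "t = 0") (auto simp: u_def)
  have w: "well i (u t $ i)" if "t \<ge> - max_delay G" for i t
  proof (cases "t \<le> 0")
    case True
    with that \<phi> show ?thesis by (auto simp: basin_iff u_def)
  next
    case False
    have "well i (y i t)"
    proof (rule well_preserved[where a = 0 and y = "y i" and P = "P i"])
      show "well i (y i 0)" using \<phi> max_delay_pos by (auto simp: basin_iff y0)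
      show "(P i has_real_derivative decay G i s) (at s)" for s
        by (rule stable_decay.antideriv[OF P])
      show "(y i has_real_derivative - decay G i s * y i s + forcing i s) (at s within {0..t})" for s
        by (rule has_field_derivative_at_within[OF y])
    qed (use False in simp)
    then show ?thesis using u[of t i] False by simp
  qed
  have "(u has_vector_derivative gnn_rhs G u t) (at t within {0..})" if t: "t \<ge> 0" for t
    unfolding has_vector_derivative_vec_iff
  proof
    fix i
    have "gnn_rhs G u t $ i = - decay G i t * u t $ i + forcing i t"
      using t by (intro rhs_saturated w) auto
    then have "(y i has_real_derivative gnn_rhs G u t $ i) (at t within {0..})"
      using has_field_derivative_at_within[OF y[of i t], of "{0..}"] u[OF t, of i] by simp
    then show "((\<lambda>x. u x $ i) has_real_derivative gnn_rhs G u t $ i) (at t within {0..})"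
      by (rule has_field_derivative_transform_within[OF _ zero_less_one]) (use t u in auto)
  qed
  then show ?thesis by (auto simp: gnn_ivp_solution_def u_def intro!: exI[of _ u])
qed

section \<open>Entire solutions: stability, existence, uniqueness\<close>

lemma entire_solution_linear:
  assumes "gnn_entire_solution G u" "\<And>t. segment u t \<in> basin G b v \<Sigma>"
  shows "((\<lambda>s. u s $ i) has_real_derivative - decay G i t * u t $ i + forcing i t) (at t)"
proof -
  have "well j (u s $ j)" for j s
    using assms(2)[of s] max_delay_pos by (auto simp: basin_iff segment_def dest!: spec[of _ j] bspec[of _ _ 0])
  then have "gnn_rhs G u t $ i = - decay G i t * u t $ i + forcing i t"
    by (intro rhs_saturated)
  with assms(1) show ?thesis
    unfolding gnn_entire_solution_def has_vector_derivative_vec_iff by metis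
qed

text \<open>The forcing cancels in the difference of two solutions, which therefore decays like
  \<open>exp (P i 0 - P i t)\<close>.\<close>

lemma entire_solution_stable:
  assumes w: "gnn_entire_solution G w" and seg: "\<And>t. segment w t \<in> basin G b v \<Sigma>"
  shows "exp_stable_in G (basin G b v \<Sigma>) w"
proof -
  obtain P \<mu> C where P: "\<And>i. stable_decay (decay G i) (P i) \<mu> C"
    using stable_decay_exists by blast
  note wl = entire_solution_linear[OF w seg]
  have contw: "continuous_on S (\<lambda>s. w s $ i)" for i S
    by (intro continuous_at_imp_continuous_on ballI DERIV_isCont[OF wl])
  \<comment> \<open>The constant is \<open>exp \<bar>C\<bar>\<close> rather than
    \<open>exp C\<close> because the stability constant must be at least 1.\<close>
  have est: "Max (range (\<lambda>i. \<bar>w t $ i - u t $ i\<bar>)) \<le>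
      exp \<bar>C\<bar> * exp (- \<mu> * t) * phase_norm G (\<lambda>s. segment w 0 s - \<phi> s)"
    if \<phi>: "\<phi> \<in> basin G b v \<Sigma>" and u: "gnn_ivp_solution G \<phi> u" and t: "t \<ge> 0" for \<phi> u t
  proof (intro Max.boundedI; clarify?)
    fix i
    interpret stable_decay "decay G i" "P i" \<mu> C by (rule P)
    let ?d = "\<lambda>s. w s $ i - u s $ i"
    have d: "(?d has_real_derivative - decay G i s * ?d s) (at s within {0..t})" if "s \<in> {0..t}" for s
    proof -
      have "((\<lambda>s. u s $ i) has_real_derivative - decay G i s * u s $ i + forcing i s) (at s within {0..t})"
        using ivp_solution_linear[OF u \<phi>, of s i] that by (auto intro: has_field_derivative_subset)
      from DERIV_diff[OF has_field_derivative_at_within[OF wl[of i s]] this] show ?thesis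
        by (simp add: algebra_simps)
    qed
    have Pw: "(P i has_real_derivative decay G i s) (at s within {0..t})" for s
      by (rule has_field_derivative_at_within[OF antideriv])
    have "?d t * exp (P i t) \<le> ?d 0 * exp (P i 0)"
      by (rule linear_comparison[OF t Pw d]) auto
    moreover have "- ?d t * exp (P i t) \<le> - ?d 0 * exp (P i 0)"
      by (rule linear_comparison[OF t Pw DERIV_minus[OF d]]) (auto simp: algebra_simps)
    ultimately have "\<bar>?d t * exp (P i t)\<bar> \<le> \<bar>?d 0 * exp (P i 0)\<bar>"
      by linarith
    then have "\<bar>?d t\<bar> * exp (P i t) \<le> \<bar>?d 0\<bar> * exp (P i 0)"
      by (simp add: abs_mult)
    then have "\<bar>?d t\<bar> \<le> \<bar>?d 0\<bar> * exp (P i 0 - P i t)"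
      by (simp add: exp_diff field_simps)
    also have "\<dots> \<le> \<bar>?d 0\<bar> * exp (\<bar>C\<bar> - \<mu> * t)"
      using growth[OF t] by (intro mult_left_mono) auto
    also have "\<bar>?d 0\<bar> \<le> phase_norm G (\<lambda>s. segment w 0 s - \<phi> s)"
    proof -
      have "u 0 = \<phi> 0" using u max_delay_pos by (auto simp: gnn_ivp_solution_def)
      moreover have "continuous_on {- max_delay G..0} (\<lambda>s. (segment w 0 s - \<phi> s) $ j)" for j
        unfolding segment_def vector_minus_component add_0_left
        using \<phi> contw by (intro continuous_on_diff) (auto simp: basin_iff)
      ultimately show ?thesis using phase_norm_ge[of "\<lambda>s. segment w 0 s - \<phi> s" i]
        by (simp add: segment_def)
    qed
    finally show "\<bar>?d t\<bar> \<le> exp \<bar>C\<bar> * exp (- \<mu> * t) * phase_norm G (\<lambda>s. segment w 0 s - \<phi> s)"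
      by (simp add: exp_diff exp_minus field_simps)
  qed auto
  have "\<mu> > 0" using stable_decay.rate_pos[OF P] .
  show ?thesis
    unfolding exp_stable_in_def
    by (intro conjI allI seg, rule exI[of _ "exp \<bar>C\<bar>"], rule conjI, simp, rule exI[of _ \<mu>])
       (intro conjI ballI allI impI \<open>\<mu> > 0\<close> ivp_solution_exists est)
qed

lemma almost_periodic_solution_exists:
  "\<exists>w. almost_periodic_vec w \<and> gnn_entire_solution G w \<and> (\<forall>t. segment w t \<in> basin G b v \<Sigma>)"
proof -
  obtain P \<mu> C where P: "\<And>i. stable_decay (decay G i) (P i) \<mu> C"
    using stable_decay_exists by blast
  have "\<exists>y B. \<forall>t. (y has_real_derivative - decay G i t * y t + forcing i t) (at t) \<and> \<bar>y t\<bar> \<le> B" for i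
  proof -
    obtain M where "\<And>t. \<bar>forcing i t\<bar> \<le> M"
      using almost_periodic_bounded[OF forcing_ap] by blast
    then show ?thesis
      using forcing_ap[of i]
      by (intro stable_decay.bounded_solution_exists[OF P]) (auto simp: almost_periodic_def)
  qed
  then obtain y B where y: "\<And>i t. (y i has_real_derivative - decay G i t * y i t + forcing i t) (at t)"
    and B: "\<And>i t. \<bar>y i t\<bar> \<le> B i" by metis
  have wy: "well i (y i t)" for i t
    by (rule bounded_solution_well[OF P y B])
  define w where "w t = (\<chi> i. y i t)" for t
  have "gnn_rhs G w t $ i = - decay G i t * w t $ i + forcing i t" for t i
    using wy by (intro rhs_saturated) (simp add: w_def)
  then have "gnn_entire_solution G w"
    using y by (simp add: gnn_entire_solution_def has_vector_derivative_vec_iff w_def)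
  moreover have "almost_periodic (y i)" for i
    by (rule stable_decay.bounded_solution_almost_periodic[OF P decay_ap forcing_ap y B])
  then have "almost_periodic_vec w" by (simp add: almost_periodic_vec_def w_def)
  moreover have "continuous_on S (y i)" for S i
    by (intro continuous_at_imp_continuous_on ballI DERIV_isCont[OF y])
  then have "continuous_on S (\<lambda>s. y i (t + s))" for S i t
    by (rule continuous_on_compose2[where t = UNIV]) (auto intro!: continuous_intros)
  then have "segment w t \<in> basin G b v \<Sigma>" for t
    using wy by (simp add: basin_iff segment_def w_def)
  ultimately show ?thesis by blast
qed

lemma entire_solution_unique:
  assumes "almost_periodic_vec u" "gnn_entire_solution G u" "\<And>t. segment u t \<in> basin G b v \<Sigma>"
    and "almost_periodic_vec w" "gnn_entire_solution G w" "\<And>t. segment w t \<in> basin G b v \<Sigma>"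
  shows "u = w"
proof -
  obtain P \<mu> C where P: "\<And>i. stable_decay (decay G i) (P i) \<mu> C"
    using stable_decay_exists by blast
  \<comment> \<open>Stated for arbitrary \<open>u\<close> and \<open>w\<close> so that it can be
    applied in both orders. Almost periodicity supplies the bound on the difference, a solution of
    the homogeneous equation.\<close>
  have "u t $ i - w t $ i \<le> 0" if u: "almost_periodic_vec u" "gnn_entire_solution G u"
      "\<And>t. segment u t \<in> basin G b v \<Sigma>" and w: "almost_periodic_vec w" "gnn_entire_solution G w"
      "\<And>t. segment w t \<in> basin G b v \<Sigma>" for u w t i
  proof -
    obtain A where A: "\<And>t. \<bar>u t $ i\<bar> \<le> A"
      using u(1) almost_periodic_bounded unfolding almost_periodic_vec_def by blast
    obtain B where B: "\<And>t. \<bar>w t $ i\<bar> \<le> B"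
      using w(1) almost_periodic_bounded unfolding almost_periodic_vec_def by blast
    show ?thesis
    proof (rule stable_decay.bounded_subsolution_nonpos[OF P[of i], where d = "\<lambda>s. u s $ i - w s $ i"])
      fix s
      show "((\<lambda>s. u s $ i - w s $ i) has_real_derivative - decay G i s * (u s $ i - w s $ i)) (at s)"
        using DERIV_diff[OF entire_solution_linear[OF u(2,3), of i s] entire_solution_linear[OF w(2,3), of i s]]
        by (simp add: algebra_simps)
      show "u s $ i - w s $ i \<le> A + B" using A[of s] B[of s] by linarith
    qed simp
  qed
  from this[OF assms] this[OF assms(4-6,1-3)] have "u t $ i = w t $ i" for t i
    by (simp add: antisym)
  then show ?thesis by (simp add: fun_eq_iff vec_eq_iff)
qed

end

theorem theorem7:
  fixes G :: "('n::finite, 'm::finite) gnn"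
    and b v :: "'n \<Rightarrow> nat \<Rightarrow> real"
    and h :: "'n \<Rightarrow> real \<Rightarrow> real"
    and \<Sigma> :: "'n \<Rightarrow> nat"
  assumes "delays_bounded G"
    and "\<And>j. class_B (b j) (v j) (h j) (act G j)"
    and "H1 G" and "H1_B G b h" and "H2_B G b v"
    and "\<And>i. \<Sigma> i \<in> {1, 2}"
  shows "\<exists>!u. almost_periodic_vec u \<and> gnn_entire_solution G u \<and>
           exp_stable_in G (basin G b v \<Sigma>) u"
proof -
  interpret saturating_gnn G b v h \<Sigma>
    using assms by unfold_locales
  obtain w where w: "almost_periodic_vec w" "gnn_entire_solution G w" "\<And>t. segment w t \<in> basin G b v \<Sigma>"
    using almost_periodic_solution_exists by blast
  show ?thesis
  proof (rule ex1I[of _ w])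
    show "almost_periodic_vec w \<and> gnn_entire_solution G w \<and> exp_stable_in G (basin G b v \<Sigma>) w"
      using w entire_solution_stable by blast
    show "u = w" if "almost_periodic_vec u \<and> gnn_entire_solution G u \<and>
        exp_stable_in G (basin G b v \<Sigma>) u" for u
      \<comment> \<open>Stability includes that all segments lie in the basin, so a competitor obeys
        the same linear equations as \<open>w\<close>.\<close>
      using that w by (intro entire_solution_unique) (auto simp: exp_stable_in_def)
  qed
qed

end
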